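(* Let $f\in\{x,y,z\}$ and define the main term $\mathcal{M}_{\mathfrak{q}}=\sum_{q\mid\mathfrak{q},\,q<Q_0}\rho(\mathfrak{q}/q)\sum_{\gamma\in\Gamma}\Upsilon_X(\gamma)\sum_{\omega\in\Omega_Y}\Xi(q;f(x_0\cdot\gamma\omega))$. Then for admissible $\mathfrak{q}$ one can write $\mathcal{M}_{\mathfrak{q}}=\beta_f(\mathfrak{q})\chi+r^{(1)}(\mathfrak{q})+r^{(2)}(\mathfrak{q})$ where, for every $\epsilon>0$ and $\mathcal{Q}\ge 1$, $$\sum_{\mathfrak{q}<\mathcal{Q}}|r^{(1)}(\mathfrak{q})|\ll_\epsilon \frac{\chi\,\mathcal{Q}^\epsilon Q_0}{X^{2(\delta-\theta)}},\qquad \sum_{\mathfrak{q}<\mathcal{Q}}|r^{(2)}(\mathfrak{q})|\ll_\epsilon \frac{\chi\,\mathcal{Q}^\epsilon}{Q_0},$$ the sums running over admissible $\mathfrak{q}$.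
   Context: Standing setup: $\Gamma\le SL(2,\mathbb{Z})$ is finitely generated, Zariski dense in $SL_2$, thin, without parabolic elements, with critical exponent $\delta>1/2$ and spectral gap parameter $\theta<\delta$. $\mathcal{B}$ is the bad modulus (for squarefree $q$ coprime to $\mathcal{B}$ the reduction $\Gamma\to SL(2,\mathbb{Z}/q\mathbb{Z})$ is surjective), $2\mid\mathcal{B}$. Admissible moduli: squarefree $\mathfrak{q}$ coprime to $\mathcal{B}$, and when $f=z$ all prime factors $\equiv1\pmod 4$. $x_0=(0,1)$, $\Gamma$ acts on row vectors on the right; $x(c,d)=d^2-c^2$, $y(c,d)=2cd$, $z(c,d)=c^2+d^2$. $\|\gamma\|^2$ is the sum of squares of the entries. $X=T^x$, $Y=T^y$ with $x+y=1$, $Q_0$ a small positive power of $T$, $\Omega_Y=\{\omega\in\Gamma:\|\omega\|<Y\}$. $\Upsilon_X:\Gamma\to[0,1]$ is a smoothed indicator equal to $1$ for $\|\gamma\|<\frac9{10}X$ and $0$ for $\|\gamma\|>\frac{11}{10}X$, with $\sum_\Gamma\Upsilon_X\sim CX^{2\delta}$ and, for every $\gamma_0\in\Gamma$, squarefree $q$ coprime to $\mathcal{B}$ and $\Gamma(q)\le\tilde\Gamma\le\Gamma$, $\sum_{\gamma\in\tilde\Gamma}\Upsilon_X(\gamma\gamma_0)=[\Gamma:\tilde\Gamma]^{-1}\sum_{\gamma\in\Gamma}\Upsilon_X(\gamma)+O(X^{2\theta})$ uniformly. $\chi=|\Omega_Y|\sum_{\gamma\in\Gamma}\Upsilon_X(\gamma)$.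 $\rho$ is multiplicative, supported on squarefree integers, $\rho(p)=\frac{2p-1}{p^2}$; $\Xi(q;n)=\prod_{p\mid q}(1_{\{n\equiv0\,(p)\}}-\rho(p))$ for squarefree $q$. $\beta_f$ is multiplicative on squarefree integers with $\beta_f(p)=\frac{2}{p+1}$ if $(p,\mathcal{B})=1$ and either $f\in\{x,y\}$ or ($f=z$ and $p\equiv1\pmod4$), and $\beta_f(p)=0$ otherwise. *)

theory Defs
  imports "HOL-Analysis.Analysis" "HOL-Library.Landau_Symbols"
    "HOL-Computational_Algebra.Squarefree" "HOL-Number_Theory.Cong"
begin

type_synonym imat = "int ^ 2 ^ 2"

definition SL2Z :: "imat set" where
  "SL2Z = {A. det A = 1}"

definition mnorm :: "imat \<Rightarrow> real" where
  "mnorm A = sqrt (\<Sum>i\<in>UNIV. \<Sum>j\<in>UNIV. (real_of_int (A $ i $ j))\<^sup>2)"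

definition sl2_inv :: "imat \<Rightarrow> imat" where
  "sl2_inv A = (\<chi> i j. if i = 1 \<and> j = 1 then A $ 2 $ 2
                          else if i = 2 \<and> j = 2 then A $ 1 $ 1
                          else - A $ i $ j)"

definition is_subgroup_SL2 :: "imat set \<Rightarrow> bool" where
  "is_subgroup_SL2 G \<longleftrightarrow> G \<subseteq> SL2Z \<and> mat 1 \<in> G \<and>
     (\<forall>A\<in>G. \<forall>B\<in>G. A ** B \<in> G) \<and> (\<forall>A\<in>G. sl2_inv A \<in> G)"

inductive_set generated :: "imat set \<Rightarrow> imat set" for S where
  gen_one: "mat 1 \<in> generated S"
| gen_mult: "A \<in> generated S \<Longrightarrow> s \<in> S \<Longrightarrow> A ** s \<in> generated S"
| gen_mult_inv: "A \<in> generated S \<Longrightarrow> s \<in> S \<Longrightarrow> A ** sl2_inv s \<in> generated S"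

definition finitely_generated :: "imat set \<Rightarrow> bool" where
  "finitely_generated G \<longleftrightarrow> (\<exists>S. finite S \<and> S \<subseteq> SL2Z \<and> G = generated S)"

definition right_cosets :: "imat set \<Rightarrow> imat set \<Rightarrow> imat set set" where
  "right_cosets H G = {(\<lambda>h. h ** g) ` H | g. g \<in> G}"

definition index :: "imat set \<Rightarrow> imat set \<Rightarrow> nat" where
  "index H G = card (right_cosets H G)"

definition infinite_index :: "imat set \<Rightarrow> bool" where
  "infinite_index G \<longleftrightarrow> infinite (right_cosets G SL2Z)"

text \<open>Polynomial functions in the four matrix entries, with complex coefficients
  (finitely supported coefficient function on exponent vectors).\<close>
definition mpoly_eval :: "(nat \<times> nat \<times> nat \<times> nat \<Rightarrow> complex) \<Rightarrow> complex ^ 2 ^ 2 \<Rightarrow> complex" where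
  "mpoly_eval c M = (\<Sum>e\<in>{e. c e \<noteq> 0}. case e of (i, j, k, l) \<Rightarrow>
      c e * (M$1$1) ^ i * (M$1$2) ^ j * (M$2$1) ^ k * (M$2$2) ^ l)"

definition zariski_dense_SL2 :: "imat set \<Rightarrow> bool" where
  "zariski_dense_SL2 G \<longleftrightarrow> (\<forall>c. finite {e. c e \<noteq> 0} \<longrightarrow>
      (\<forall>g\<in>G. mpoly_eval c (\<chi> i j. of_int (g $ i $ j)) = 0) \<longrightarrow>
      (\<forall>M :: complex^2^2. det M = 1 \<longrightarrow> mpoly_eval c M = 0))"

definition no_parabolics :: "imat set \<Rightarrow> bool" where
  "no_parabolics G \<longleftrightarrow> (\<forall>g\<in>G. \<bar>g$1$1 + g$2$2\<bar> = 2 \<longrightarrow> g = mat 1 \<or> g = - mat 1)"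

definition critical_exponent :: "imat set \<Rightarrow> real" where
  "critical_exponent G = Inf {s. (\<lambda>g. mnorm g powr (- 2 * s)) summable_on G}"

definition mat_cong :: "imat \<Rightarrow> imat \<Rightarrow> int \<Rightarrow> bool" where
  "mat_cong A B q \<longleftrightarrow> (\<forall>i j. [A$i$j = B$i$j] (mod q))"

definition surj_mod :: "imat set \<Rightarrow> nat \<Rightarrow> bool" where
  "surj_mod G q \<longleftrightarrow> (\<forall>M::imat. [det M = 1] (mod int q) \<longrightarrow> (\<exists>g\<in>G. mat_cong g M (int q)))"

definition principal_congruence :: "imat set \<Rightarrow> nat \<Rightarrow> imat set" where
  "principal_congruence G q = {g\<in>G. mat_cong g (mat 1) (int q)}"

definition x0 :: "int ^ 2" where
  "x0 = vector [0, 1]"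

datatype quad_form = Fx | Fy | Fz

fun feval :: "quad_form \<Rightarrow> int ^ 2 \<Rightarrow> int" where
  "feval Fx v = (v$2)\<^sup>2 - (v$1)\<^sup>2"
| "feval Fy v = 2 * (v$1) * (v$2)"
| "feval Fz v = (v$1)\<^sup>2 + (v$2)\<^sup>2"

definition admissible :: "nat \<Rightarrow> quad_form \<Rightarrow> nat \<Rightarrow> bool" where
  "admissible B f q \<longleftrightarrow> squarefree q \<and> coprime q B \<and>
     (f = Fz \<longrightarrow> (\<forall>p\<in>prime_factors q. [p = 1] (mod 4)))"

definition rho :: "nat \<Rightarrow> real" where
  "rho n = (if squarefree n then (\<Prod>p\<in>prime_factors n. (2 * real p - 1) / (real p)\<^sup>2) else 0)"

definition Xi :: "nat \<Rightarrow> int \<Rightarrow> real" where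
  "Xi q n = (\<Prod>p\<in>prime_factors q. (if int p dvd n then 1 else 0) - rho p)"

definition beta_p :: "nat \<Rightarrow> quad_form \<Rightarrow> nat \<Rightarrow> real" where
  "beta_p B f p = (if coprime p B \<and> (f \<in> {Fx, Fy} \<or> (f = Fz \<and> [p = 1] (mod 4)))
                   then 2 / (real p + 1) else 0)"

definition beta :: "nat \<Rightarrow> quad_form \<Rightarrow> nat \<Rightarrow> real" where
  "beta B f n = (if squarefree n then (\<Prod>p\<in>prime_factors n. beta_p B f p) else 0)"

definition Omega :: "imat set \<Rightarrow> real \<Rightarrow> imat set" where
  "Omega G Y = {w\<in>G. mnorm w < Y}"

definition chi :: "imat set \<Rightarrow> (real \<Rightarrow> imat \<Rightarrow> real) \<Rightarrow> real \<Rightarrow> real \<Rightarrow> real" where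
  "chi G Ups X Y = real (card (Omega G Y)) * (\<Sum>\<^sub>\<infinity>g\<in>G. Ups X g)"

definition main_term :: "imat set \<Rightarrow> (real \<Rightarrow> imat \<Rightarrow> real) \<Rightarrow> quad_form \<Rightarrow>
     real \<Rightarrow> real \<Rightarrow> real \<Rightarrow> nat \<Rightarrow> real" where
  "main_term G Ups f X Y Q0 qq =
     (\<Sum>q\<in>{q. q dvd qq \<and> real q < Q0}. rho (qq div q) *
        (\<Sum>\<^sub>\<infinity>g\<in>G. Ups X g * (\<Sum>w\<in>Omega G Y. Xi q (feval f (x0 v* (g ** w))))))"

end

theory Submission
  imports Defs "HOL-Number_Theory.Euler_Criterion"
begin

text \<open>Whether \<open>p\<close> divides \<open>f(x\<^sub>0 \<gamma> \<omega>)\<close> depends only on the point of the projective line over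
  the field with \<open>p\<close> elements given by the bottom row of \<open>\<gamma> \<omega>\<close>, and exactly 2 of the \<open>p + 1\<close>
  points are zeros of \<open>f\<close>. Equidistribution is therefore applied to the stabilizer \<open>\<Gamma>\<^sub>0\<close> of a
  projective point, not of the vector \<open>x\<^sub>0\<close>: with only \<open>2 ^ \<omega>(d)\<close> cosets to count modulo \<open>d\<close>,
  the error for each \<open>q\<close> is \<open>3 ^ \<omega>(q) X ^ (2 \<theta>)\<close>, which summed over \<open>q < Q\<^sub>0\<close> costs a single factor
  \<open>Q\<^sub>0\<close>. The main terms \<open>\<Prod>\<^bsub>p | q\<^esub> (\<beta>(p) - \<rho>(p))\<close> convolve with \<open>\<rho>\<close> to \<open>\<beta>\<close>; completing the sum
  over \<open>q < Q\<^sub>0\<close> costs \<open>r\<^sup>(\<^sup>2\<^sup>)\<close>, which is small because \<open>\<bar>\<beta>(p) - \<rho>(p)\<bar> \<le> 1 / p\<^sup>2\<close>. Since nothing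
  bounds \<open>\<Sum> \<Upsilon>\<^sub>X\<close> from below for small \<open>X\<close>, bounded \<open>X\<close> is treated by the trivial estimate
  \<open>\<bar>\<Xi>\<bar> \<le> 1\<close>.\<close>

subsection \<open>The projective line modulo a prime\<close>

lemma sl2_inv_entries:
  "sl2_inv A $ 1 $ 1 = A $ 2 $ 2" "sl2_inv A $ 1 $ 2 = - A $ 1 $ 2"
  "sl2_inv A $ 2 $ 1 = - A $ 2 $ 1" "sl2_inv A $ 2 $ 2 = A $ 1 $ 1"
  by (simp_all add: sl2_inv_def)

lemma mult_entry: "((A::imat) ** B) $ i $ j = A $ i $ 1 * B $ 1 $ j + A $ i $ 2 * B $ 2 $ j"
  by (simp add: matrix_matrix_mult_def sum_2)

lemma imat_eq_iff: "(A::imat) = B \<longleftrightarrow>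
    A$1$1 = B$1$1 \<and> A$1$2 = B$1$2 \<and> A$2$1 = B$2$1 \<and> A$2$2 = B$2$2"
  by (auto simp: vec_eq_iff forall_2)

lemma x0_mult: "(x0 v* A) $ j = A $ 2 $ j"
  by (simp add: vector_matrix_mult_def x0_def sum_2)

lemma SL2Z_det: "A \<in> SL2Z \<Longrightarrow> A$1$1 * A$2$2 - A$1$2 * A$2$1 = 1"
  by (simp add: SL2Z_def det_2)

lemma sl2_inv_right: "A \<in> SL2Z \<Longrightarrow> A ** sl2_inv A = mat 1"
  using SL2Z_det[of A] by (simp add: imat_eq_iff mult_entry sl2_inv_entries mat_def algebra_simps)

lemma sl2_inv_left: "A \<in> SL2Z \<Longrightarrow> sl2_inv A ** A = mat 1"
  using SL2Z_det[of A] by (simp add: imat_eq_iff mult_entry sl2_inv_entries mat_def algebra_simps)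

lemma inj_mult_right:
  assumes "g \<in> SL2Z"
  shows "inj_on (\<lambda>h. h ** g) H"
proof (rule inj_onI)
  fix x y assume "x ** g = y ** g"
  then have "x ** (g ** sl2_inv g) = y ** (g ** sl2_inv g)" by (simp add: matrix_mul_assoc)
  then show "x = y" by (simp add: sl2_inv_right assms)
qed

text \<open>The point \<open>[g\<^sub>2\<^sub>1 : g\<^sub>2\<^sub>2]\<close> of the projective line over the field with \<open>p\<close> elements,
  with \<open>p\<close> standing for the point at infinity.\<close>
definition slope :: "nat \<Rightarrow> imat \<Rightarrow> nat" where
  "slope p g = (if int p dvd g$2$2 then p
                else (LEAST t. [g$2$2 * int t = g$2$1] (mod int p)))"

text \<open>A section of the coding by \<open>slope\<close>: modulo \<open>p\<close> the bottom row
  of a matrix in \<open>SL2Z\<close> is a unit multiple of the vector attached to its code.\<close>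

definition slope_vec :: "nat \<Rightarrow> nat \<Rightarrow> int ^ 2" where
  "slope_vec p t = vector [if t = p then 1 else int t, if t = p then 0 else 1]"

definition slope_zeros :: "nat \<Rightarrow> quad_form \<Rightarrow> nat set" where
  "slope_zeros p f = {t\<in>{0..p}. int p dvd feval f (slope_vec p t)}"

lemma slope_finite:
  assumes "prime p" "\<not> int p dvd g$2$2"
  shows "slope p g < p" "[g$2$2 * int (slope p g) = g$2$1] (mod int p)"
proof -
  have "coprime (g$2$2) (int p)"
    using assms by (metis coprime_commute prime_imp_coprime prime_nat_int_transfer)
  then obtain x where x: "[g$2$2 * x = 1] (mod int p)" using cong_solve_coprime_int by blast
  define t where "t = nat ((x * g$2$1) mod int p)"
  have p: "p > 0" using assms(1) prime_gt_0_nat by blast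
  have t: "int t = (x * g$2$1) mod int p" "t < p" using p by (auto simp: t_def nat_less_iff)
  have "[g$2$2 * int t = g$2$2 * (x * g$2$1)] (mod int p)"
    unfolding t by (simp add: cong_def mod_mult_right_eq)
  also have "g$2$2 * (x * g$2$1) = (g$2$2 * x) * g$2$1" by simp
  also have "[(g$2$2 * x) * g$2$1 = 1 * g$2$1] (mod int p)"
    using x by (rule cong_mult) simp
  finally have T: "[g$2$2 * int t = g$2$1] (mod int p)" by simp
  have s: "slope p g = (LEAST t. [g$2$2 * int t = g$2$1] (mod int p))"
    using assms by (simp add: slope_def)
  show "[g$2$2 * int (slope p g) = g$2$1] (mod int p)" unfolding s by (rule LeastI, rule T)
  show "slope p g < p" unfolding s using Least_le[of "\<lambda>t. [g$2$2 * int t = g$2$1] (mod int p)", OF T] t(2) by linarith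
qed

lemma slope_le: "prime p \<Longrightarrow> slope p g \<le> p"
  using slope_finite(1)[of p g] by (cases "int p dvd g$2$2") (auto simp: slope_def)

lemma slope_eqI:
  assumes "prime p" "\<not> int p dvd g$2$2" "t < p" "[g$2$2 * int t = g$2$1] (mod int p)"
  shows "slope p g = t"
proof -
  have "[g$2$2 * int (slope p g) = g$2$2 * int t] (mod int p)"
    using slope_finite(2)[OF assms(1,2)] cong_sym[OF assms(4)] by (rule cong_trans)
  moreover have "coprime (g$2$2) (int p)"
    using assms by (metis coprime_commute prime_imp_coprime prime_nat_int_transfer)
  ultimately have "[int (slope p g) = int t] (mod int p)"
    by (simp add: cong_mult_lcancel)
  then have "[slope p g = t] (mod p)" by (simp add: cong_int_iff)
  then show ?thesis using slope_finite(1)[OF assms(1,2)] assms(3) by (simp add: cong_def)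
qed

lemma bottom_row_primitive:
  assumes "g \<in> SL2Z" "prime p" "int p dvd g$2$2" shows "\<not> int p dvd g$2$1"
proof
  assume "int p dvd g$2$1"
  then have "int p dvd g$1$1 * g$2$2 - g$1$2 * g$2$1" using assms by auto
  then show False using SL2Z_det[OF assms(1)] assms(2) by auto
qed

text \<open>Two projective points agree when the determinant of their representatives vanishes. This
  form is chosen because that determinant is the lower left entry of \<open>g ** sl2_inv h\<close>,
  which turns equality of points into a coset condition.\<close>

lemma slope_eq_iff:
  assumes "g \<in> SL2Z" "h \<in> SL2Z" "prime p"
  shows "slope p g = slope p h \<longleftrightarrow> int p dvd g$2$1 * h$2$2 - g$2$2 * h$2$1"
proof -
  have pr: "prime (int p)" using assms(3) by simp
  \<comment> \<open>The cases record which of the points lie at infinity. If exactly one does, both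
    sides are false because bottom rows are primitive; only two affine points need a
    computation.\<close>
  consider "int p dvd g$2$2" "int p dvd h$2$2" | "int p dvd g$2$2" "\<not> int p dvd h$2$2"
    | "\<not> int p dvd g$2$2" "int p dvd h$2$2" | "\<not> int p dvd g$2$2" "\<not> int p dvd h$2$2" by blast
  then show ?thesis
  proof cases
    case 1 then show ?thesis by (auto simp: slope_def)
  next
    case 2
    have "\<not> int p dvd g$2$1 * h$2$2"
      using 2 bottom_row_primitive[OF assms(1,3)] prime_dvd_multD[OF pr] by blast
    moreover have "slope p g = p" "slope p h < p" using 2 slope_finite(1)[OF assms(3)] by (auto simp: slope_def)
    ultimately show ?thesis using 2 by (auto simp: dvd_diff_left_iff)
  next
    case 3
    have "\<not> int p dvd g$2$2 * h$2$1"
      using 3 bottom_row_primitive[OF assms(2,3)] prime_dvd_multD[OF pr] by blast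
    moreover have "slope p h = p" "slope p g < p" using 3 slope_finite(1)[OF assms(3)] by (auto simp: slope_def)
    ultimately show ?thesis using 3 by (auto simp: dvd_diff_right_iff)
  next
    case 4
    note S = slope_finite[OF assms(3)]
    show ?thesis
    proof
      assume eq: "slope p g = slope p h"
      have "[g$2$1 * h$2$2 = (g$2$2 * int (slope p g)) * h$2$2] (mod int p)"
        using S(2)[OF 4(1)] by (intro cong_mult cong_refl) (rule cong_sym)
      also have "(g$2$2 * int (slope p g)) * h$2$2 = g$2$2 * (h$2$2 * int (slope p h))"
        by (simp add: eq)
      also have "[g$2$2 * (h$2$2 * int (slope p h)) = g$2$2 * h$2$1] (mod int p)"
        using S(2)[OF 4(2)] by (intro cong_mult cong_refl)
      finally show "int p dvd g$2$1 * h$2$2 - g$2$2 * h$2$1" by (simp add: cong_iff_dvd_diff)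
    next
      assume "int p dvd g$2$1 * h$2$2 - g$2$2 * h$2$1"
      then have 1: "[g$2$2 * h$2$1 = h$2$2 * g$2$1] (mod int p)"
        by (simp add: cong_iff_dvd_diff dvd_diff_commute mult.commute)
      have "h$2$2 * (g$2$2 * int (slope p h)) = g$2$2 * (h$2$2 * int (slope p h))"
        by (simp add: mult_ac)
      also have "[g$2$2 * (h$2$2 * int (slope p h)) = g$2$2 * h$2$1] (mod int p)"
        using S(2)[OF 4(2)] by (intro cong_mult cong_refl)
      also note 1
      finally have "int p dvd h$2$2 * (g$2$2 * int (slope p h) - g$2$1)"
        by (simp add: cong_iff_dvd_diff algebra_simps)
      then have "[g$2$2 * int (slope p h) = g$2$1] (mod int p)"
        using 4(2) by (simp add: prime_dvd_mult_iff[OF pr] cong_iff_dvd_diff)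
      then show "slope p g = slope p h" using slope_eqI[OF assms(3) 4(1) S(1)[OF 4(2)]] by blast
    qed
  qed
qed

lemma feval_cong:
  assumes "[v$1 = w$1] (mod m)" "[v$2 = w$2] (mod m)"
  shows "[feval f v = feval f w] (mod m)"
  using assms by (cases f) (auto intro!: cong_add cong_diff cong_mult cong_pow)

text \<open>Each form is homogeneous of degree two, so rescaling the bottom row by a unit
  \<open>k\<close> modulo \<open>p\<close> multiplies the value by the unit
  \<open>k^2\<close>.\<close>

lemma feval_dvd_iff_slope:
  assumes "g \<in> SL2Z" "prime p"
  shows "int p dvd feval f (x0 v* g) \<longleftrightarrow> slope p g \<in> slope_zeros p f"
proof -
  have pr: "prime (int p)" using assms(2) by simp
  obtain k where k: "\<not> int p dvd k"
    "[g$2$1 = k * slope_vec p (slope p g) $ 1] (mod int p)"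
    "[g$2$2 = k * slope_vec p (slope p g) $ 2] (mod int p)"
  proof (cases "int p dvd g$2$2")
    case True
    then have "slope p g = p" by (simp add: slope_def)
    then show thesis using that[of "g$2$1"] bottom_row_primitive[OF assms True] True
      by (simp add: slope_vec_def cong_0_iff)
  next
    case False
    note S = slope_finite[OF assms(2) False]
    then have "slope p g \<noteq> p" by simp
    then show thesis using that[of "g$2$2"] S False by (simp add: slope_vec_def cong_sym)
  qed
  have "[feval f (x0 v* g) = feval f (vector [k * slope_vec p (slope p g) $ 1, k * slope_vec p (slope p g) $ 2])] (mod int p)"
    by (rule feval_cong) (use k in \<open>auto simp: x0_mult\<close>)
  also have "feval f (vector [k * slope_vec p (slope p g) $ 1, k * slope_vec p (slope p g) $ 2])
     = k\<^sup>2 * feval f (slope_vec p (slope p g))"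
    by (cases f) (auto simp: algebra_simps power2_eq_square)
  finally have "int p dvd feval f (x0 v* g) \<longleftrightarrow> int p dvd k\<^sup>2 * feval f (slope_vec p (slope p g))"
    by (rule cong_dvd_iff)
  also have "\<dots> \<longleftrightarrow> int p dvd feval f (slope_vec p (slope p g))"
    using k(1) pr by (auto simp: prime_dvd_mult_iff prime_dvd_power_iff)
  finally show ?thesis using slope_le[OF assms(2)] by (simp add: slope_zeros_def)
qed

text \<open>In the affine coordinate \<open>t\<close> the zeros are \<open>1\<close> and
  \<open>-1\<close> for \<open>Fx\<close>, the points \<open>0\<close> and infinity for
  \<open>Fy\<close>, and the square roots of \<open>-1\<close> for \<open>Fz\<close>; the last exist
  because \<open>p\<close> is 1 modulo 4.\<close>

lemma card_slope_zeros:
  assumes p: "prime p" "odd p" and f: "f = Fz \<Longrightarrow> [p = 1] (mod 4)"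
  shows "card (slope_zeros p f) = 2"
proof -
  have pr: "prime (int p)" using p by simp
  have p3: "p > 2" using p prime_ge_2_nat[of p] by (cases "p = 2") auto
  have n2: "\<not> int p dvd 2" using p3 zdvd_imp_le[of "int p" 2] by auto
  \<comment> \<open>Shared by \<open>Fx\<close> with \<open>e = 1\<close> and \<open>Fz\<close> with
    \<open>e = -1\<close>: a root \<open>c\<close> of \<open>t^2 = e\<close> that is a unit modulo
    \<open>p\<close> gives exactly the roots \<open>c\<close> and \<open>-c\<close>, represented
    below \<open>p\<close> by \<open>a\<close> and \<open>p - a\<close>.\<close>
  have two: thesis if "int p dvd c\<^sup>2 - e" "\<not> int p dvd c" and z: "slope_zeros p f = {t. t < p \<and> int p dvd (int t)\<^sup>2 - e}"
      and th: "card (slope_zeros p f) = 2 \<Longrightarrow> thesis" for c e thesis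
  proof -
    define a where "a = nat (c mod int p)"
    have a: "a < p" "int a = c mod int p" using p3 by (auto simp: a_def nat_less_iff)
    have a0: "a \<noteq> 0" using a that(2) by (auto simp: dvd_eq_mod_eq_0)
    have ca: "[int a = c] (mod int p)" by (simp add: a cong_def)
    have "{t. t < p \<and> int p dvd (int t)\<^sup>2 - e} = {a, p - a}"
    proof -
      have key: "int p dvd (int t)\<^sup>2 - e \<longleftrightarrow> t = a \<or> t = p - a" if t: "t < p" for t
      proof -
        have "[(int t)\<^sup>2 - e = (int t)\<^sup>2 - c\<^sup>2] (mod int p)"
          using \<open>int p dvd c\<^sup>2 - e\<close> by (simp add: cong_iff_dvd_diff)
        also have "[(int t)\<^sup>2 - c\<^sup>2 = (int t)\<^sup>2 - (int a)\<^sup>2] (mod int p)"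
          using ca by (intro cong_diff cong_refl cong_pow) (rule cong_sym)
        finally have "int p dvd (int t)\<^sup>2 - e \<longleftrightarrow> int p dvd (int t - int a) * (int t + int a)"
          by (subst cong_dvd_iff, assumption) (simp add: algebra_simps power2_eq_square)
        also have "\<dots> \<longleftrightarrow> int p dvd (int t - int a) \<or> int p dvd int (t + a)"
          by (simp add: prime_dvd_mult_iff[OF pr])
        also have "int p dvd (int t - int a) \<longleftrightarrow> t = a"
        proof -
          have "int p dvd (int t - int a) \<longleftrightarrow> [int t = int a] (mod int p)"
            by (simp add: cong_iff_dvd_diff)
          also have "\<dots> \<longleftrightarrow> [t = a] (mod p)" by (rule cong_int_iff)
          finally show ?thesis using t a(1) by (simp add: cong_def)
        qed
        also have "int p dvd int (t + a) \<longleftrightarrow> t = p - a"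
        proof
          assume "int p dvd int (t + a)"
          then have "p dvd t + a" by (simp only: int_dvd_int_iff)
          then obtain m where m: "t + a = p * m" by blast
          \<comment> \<open>The bounds \<open>0 < a\<close> and \<open>t + a < 2 * p\<close> leave
            no other multiple of \<open>p\<close>.\<close>
          have "m = 1"
          proof (cases m)
            case 0 then show ?thesis using m a0 by simp
          next
            case (Suc m')
            then show ?thesis using m t a(1) by (cases m') auto
          qed
          then show "t = p - a" using m by simp
        qed (use a in auto)
        finally show ?thesis .
      qed
      have "{t. t < p \<and> int p dvd (int t)\<^sup>2 - e} = {t. t < p \<and> (t = a \<or> t = p - a)}"
        using key by blast
      also have "\<dots> = {a, p - a}" using a(1) a0 by auto
      finally show ?thesis .
    qed
    \<comment> \<open>For odd \<open>p\<close> the two roots are distinct.\<close>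
    moreover have "a \<noteq> p - a" using p(2) a(1) by presburger
    ultimately show thesis using th z by simp
  qed
  show ?thesis
  proof (cases f)
    case Fx
    show ?thesis
    proof (rule two[of 1 1])
      show "\<not> int p dvd 1" using pr by auto
      show "slope_zeros p f = {t. t < p \<and> int p dvd (int t)\<^sup>2 - 1}"
      proof (rule Set.set_eqI)
        fix t
        show "t \<in> slope_zeros p f \<longleftrightarrow> t \<in> {t. t < p \<and> int p dvd (int t)\<^sup>2 - 1}"
          using Fx \<open>\<not> int p dvd 1\<close> dvd_minus_iff[of "int p" "(int t)\<^sup>2 - 1"]
          by (auto simp: slope_zeros_def slope_vec_def)
      qed
    qed auto
  next
    case Fy
    have "t \<in> slope_zeros p f \<longleftrightarrow> t \<in> {0, p}" for t
    proof (cases "t < p")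
      case True
      have "int p dvd 2 * int t \<longleftrightarrow> p dvd t"
        using n2 by (simp add: prime_dvd_mult_iff[OF pr])
      also have "\<dots> \<longleftrightarrow> t = 0" using True by (auto dest: nat_dvd_not_less)
      finally show ?thesis using True Fy by (simp add: slope_zeros_def slope_vec_def)
    qed (use Fy in \<open>auto simp: slope_zeros_def slope_vec_def\<close>)
    then have "slope_zeros p f = {0, p}" by blast
    then show ?thesis using p3 by simp
  next
    case Fz
    \<comment> \<open>Euler's criterion: the exponent is even when \<open>p\<close> is 1 modulo 4,
      so \<open>-1\<close> is a square modulo \<open>p\<close>.\<close>
    have "[Legendre (-1) (int p) = (-1) ^ ((p - 1) div 2)] (mod int p)"
      using euler_criterion[of p "-1"] p3 p by simp
    moreover have "even ((p - 1) div 2)"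
    proof -
      have "p mod 4 = 1" using f[OF Fz] by (simp add: cong_def)
      then show ?thesis by presburger
    qed
    ultimately have L: "[Legendre (-1) (int p) = 1] (mod int p)" by simp
    have "QuadRes (int p) (-1)"
    proof (rule ccontr)
      assume "\<not> QuadRes (int p) (-1)"
      moreover have "\<not> [-1 = 0] (mod int p)" using p3 by (simp add: cong_0_iff)
      ultimately have "Legendre (-1) (int p) = -1" by (simp add: Legendre_def)
      then have "int p dvd - 2" using L by (simp add: cong_iff_dvd_diff)
      then show False using n2 by (simp only: dvd_minus_iff)
    qed
    then obtain c where "[c\<^sup>2 = -1] (mod int p)" by (auto simp: QuadRes_def)
    then have c: "int p dvd c\<^sup>2 - (-1)" by (simp add: cong_iff_dvd_diff)
    show ?thesis
    proof (rule two[OF c])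
      have n1: "\<not> int p dvd 1" using pr by auto
      show "\<not> int p dvd c"
      proof
        assume "int p dvd c" then have "int p dvd c\<^sup>2" by (simp add: power2_eq_square)
        then have "int p dvd (c\<^sup>2 - (-1)) - c\<^sup>2" using c by (rule dvd_diff[rotated])
        then show False using n1 by simp
      qed
      show "slope_zeros p f = {t. t < p \<and> int p dvd (int t)\<^sup>2 - (-1)}"
      proof (rule Set.set_eqI)
        fix t
        consider "t < p" | "t = p" | "t > p" by linarith
        then show "t \<in> slope_zeros p f \<longleftrightarrow> t \<in> {t. t < p \<and> int p dvd (int t)\<^sup>2 - (-1)}"
          by cases (use Fz n1 in \<open>simp_all add: slope_zeros_def slope_vec_def\<close>)
      qed
    qed
  qed
qed

subsection \<open>Congruence subgroups and equidistribution\<close>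

text \<open>Restricting to \<open>P\<close> makes the tuple extensional: equality of tuples means
  agreement on \<open>P\<close>, and the possible tuples form a \<open>PiE\<close> whose cardinality
  is a product.\<close>

definition slopes :: "nat set \<Rightarrow> imat \<Rightarrow> nat \<Rightarrow> nat" where
  "slopes P g = (\<lambda>p\<in>P. slope p g)"

text \<open>The stabilizer of the point \<open>[0 : 1]\<close> of the projective line modulo \<open>\<Prod>P\<close>.\<close>
definition Gamma0 :: "imat set \<Rightarrow> nat set \<Rightarrow> imat set" where
  "Gamma0 G P = {h\<in>G. \<forall>p\<in>P. int p dvd h$2$1}"

lemma subgroupD:
  assumes "is_subgroup_SL2 G"
  shows "G \<subseteq> SL2Z" "mat 1 \<in> G" "\<And>a b. a \<in> G \<Longrightarrow> b \<in> G \<Longrightarrow> a ** b \<in> G"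
    "\<And>a. a \<in> G \<Longrightarrow> sl2_inv a \<in> G"
  using assms by (auto simp: is_subgroup_SL2_def)

lemma subgroup_Gamma0: "is_subgroup_SL2 G \<Longrightarrow> is_subgroup_SL2 (Gamma0 G P)"
  by (auto simp: is_subgroup_SL2_def Gamma0_def mult_entry sl2_inv_entries mat_def)

lemma Gamma0_subset: "Gamma0 G P \<subseteq> G"
  by (auto simp: Gamma0_def)

text \<open>This containment places \<open>Gamma0\<close> among the groups covered by the
  equidistribution hypothesis, at level \<open>\<Prod>P\<close>.\<close>

lemma principal_congruence_le_Gamma0:
  assumes "finite P"
  shows "principal_congruence G (\<Prod>P) \<subseteq> Gamma0 G P"
proof
  fix h assume h: "h \<in> principal_congruence G (\<Prod>P)"
  then have "[h$2$1 = (mat 1 :: imat)$2$1] (mod int (\<Prod>P))"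
    by (auto simp: principal_congruence_def mat_cong_def)
  then have 1: "int (\<Prod>P) dvd h$2$1" by (simp add: mat_def cong_0_iff)
  have "int p dvd h$2$1" if "p \<in> P" for p
  proof -
    have "p dvd \<Prod>P" using dvd_prodI[OF assms that, of "\<lambda>x. x"] by simp
    then have "int p dvd int (\<Prod>P)" by (simp only: int_dvd_int_iff)
    then show ?thesis using 1 by (rule dvd_trans)
  qed
  then show "h \<in> Gamma0 G P" using h by (auto simp: Gamma0_def principal_congruence_def)
qed

lemma slopes_in_PiE: "(\<And>p. p \<in> P \<Longrightarrow> prime p) \<Longrightarrow> slopes P g \<in> (\<Pi>\<^sub>E p\<in>P. {0..p})"
  using slope_le by (auto simp: slopes_def)

lemma slopes_eq_iff: "slopes P g = slopes P h \<longleftrightarrow> (\<forall>p\<in>P. slope p g = slope p h)"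
  by (auto simp: slopes_def fun_eq_iff restrict_def)

text \<open>Orbit and stabilizer: \<open>x\<close> and \<open>g\<close> have the same point modulo
  \<open>p\<close> iff \<open>p\<close> divides the lower left entry of
  \<open>x ** sl2_inv g\<close>, so the fibres of \<open>slopes P\<close> are right cosets.\<close>

lemma slopes_fibre:
  assumes G: "is_subgroup_SL2 G" and g: "g \<in> G" and P: "\<And>p. p \<in> P \<Longrightarrow> prime p"
  shows "{x\<in>G. slopes P x = slopes P g} = (\<lambda>h. h ** g) ` Gamma0 G P"
proof (intro equalityI subsetI)
  fix x assume "x \<in> {x\<in>G. slopes P x = slopes P g}"
  then have x: "x \<in> G" "\<And>p. p \<in> P \<Longrightarrow> slope p x = slope p g" by (auto simp: slopes_eq_iff)
  have gS: "g \<in> SL2Z" "x \<in> SL2Z" using subgroupD(1)[OF G] g x by auto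
  have "x ** sl2_inv g \<in> Gamma0 G P"
  proof -
    have "x ** sl2_inv g \<in> G" using subgroupD[OF G] x g by blast
    moreover have "int p dvd (x ** sl2_inv g)$2$1" if p: "p \<in> P" for p
      using x(2)[OF p] slope_eq_iff[OF gS(2,1) P[OF p]] by (simp add: mult_entry sl2_inv_entries)
    ultimately show ?thesis by (simp add: Gamma0_def)
  qed
  moreover have "x = (x ** sl2_inv g) ** g"
    by (simp add: sl2_inv_left[OF gS(1)] flip: matrix_mul_assoc)
  ultimately show "x \<in> (\<lambda>h. h ** g) ` Gamma0 G P" by blast
next
  fix x assume "x \<in> (\<lambda>h. h ** g) ` Gamma0 G P"
  then obtain h where h: "x = h ** g" "h \<in> G" "\<And>p. p \<in> P \<Longrightarrow> int p dvd h$2$1"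
    by (auto simp: Gamma0_def)
  have x: "x \<in> G" using h g subgroupD[OF G] by blast
  have S: "g \<in> SL2Z" "x \<in> SL2Z" using subgroupD(1)[OF G] g x by auto
  have "slope p x = slope p g" if p: "p \<in> P" for p
  proof -
    \<comment> \<open>The determinant of the bottom rows of \<open>h ** g\<close> and
      \<open>g\<close> is the lower left entry of \<open>h\<close> times
      \<open>det g\<close>.\<close>
    have "x$2$1 * g$2$2 - x$2$2 * g$2$1 = h$2$1 * (g$1$1 * g$2$2 - g$1$2 * g$2$1)"
      unfolding h(1) mult_entry by (simp add: algebra_simps)
    then show ?thesis using slope_eq_iff[OF S(2,1) P[OF p]] h(3)[OF p] by simp
  qed
  then show "x \<in> {x\<in>G. slopes P x = slopes P g}" using x by (simp add: slopes_eq_iff)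
qed

text \<open>Transitivity on tuples of points: the Chinese remainder theorem produces an integer
  matrix with the prescribed bottom row and determinant 1 modulo every prime of \<open>P\<close>,
  and \<open>surj_mod\<close> lifts it to \<open>G\<close>.\<close>

lemma slopes_surj:
  assumes G: "is_subgroup_SL2 G" and P: "finite P" "\<And>p. p \<in> P \<Longrightarrow> prime p"
    and surj: "surj_mod G (\<Prod>P)" and t: "t \<in> (\<Pi>\<^sub>E p\<in>P. {0..p})"
  obtains g where "g \<in> G" "slopes P g = t"
proof -
  have cop: "\<forall>p\<in>P. \<forall>q\<in>P. p \<noteq> q \<longrightarrow> coprime p q" using P(2) primes_coprime by blast
  have crt: "\<exists>x. \<forall>p\<in>P. [x = u p] (mod p)" for u :: "nat \<Rightarrow> nat"
    using chinese_remainder_nat[OF P(1) cop] .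
  \<comment> \<open>Modulo \<open>p\<close> the matrix is to have rows
    \<open>(1, 0), (t p, 1)\<close> for an affine point and \<open>(0, -1), (1, 0)\<close> at
    infinity. The diagonal entries agree in both cases, so three applications suffice;
    \<open>p - 1\<close> stands for \<open>-1\<close> because the residues are naturals.\<close>
  obtain a where a: "\<And>p. p \<in> P \<Longrightarrow> [a = (if t p = p then 0 else 1)] (mod p)"
    using crt[of "\<lambda>p. if t p = p then 0 else 1"] by blast
  obtain b where b: "\<And>p. p \<in> P \<Longrightarrow> [b = (if t p = p then p - 1 else 0)] (mod p)"
    using crt[of "\<lambda>p. if t p = p then p - 1 else 0"] by blast
  obtain c where c: "\<And>p. p \<in> P \<Longrightarrow> [c = (if t p = p then 1 else t p)] (mod p)"
    using crt[of "\<lambda>p. if t p = p then 1 else t p"] by blast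
  define M :: imat where "M = vector [vector [int a, int b], vector [int c, int a]]"
  have M: "M$1$1 = int a" "M$1$2 = int b" "M$2$1 = int c" "M$2$2 = int a"
    by (simp_all add: M_def)
  have ai: "[int a = (if t p = p then 0 else 1)] (mod int p)" if "p \<in> P" for p
    using a[OF that] by (auto simp flip: cong_int_iff split: if_splits)
  have ci: "[int c = (if t p = p then 1 else int (t p))] (mod int p)" if "p \<in> P" for p
    using c[OF that] by (auto simp flip: cong_int_iff split: if_splits)
  have bi: "[int b = (if t p = p then -1 else 0)] (mod int p)" if "p \<in> P" for p
  proof -
    have "[int b = int (if t p = p then p - 1 else 0)] (mod int p)"
      using b[OF that] by (simp only: cong_int_iff)
    also have "[int (if t p = p then p - 1 else 0) = (if t p = p then -1 else 0)] (mod int p)"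
      using prime_gt_0_nat[OF P(2)[OF that]] by (auto simp: cong_iff_dvd_diff of_nat_diff)
    finally show ?thesis .
  qed
  have "[det M = 1] (mod int p)" if p: "p \<in> P" for p
  proof -
    have "[int a * int a - int b * int c =
       (if t p = p then 0 else 1) * (if t p = p then 0 else 1)
       - (if t p = p then -1 else 0) * (if t p = p then 1 else int (t p))] (mod int p)"
      by (intro cong_diff cong_mult ai bi ci p)
    then show ?thesis by (simp add: det_2 M split: if_splits)
  qed
  then have "[det M = 1] (mod (\<Prod>p\<in>P. int p))"
    by (intro cong_cong_prod_coprime) (use cop in auto)
  then have "[det M = 1] (mod int (\<Prod>P))" by simp
  then obtain g where g: "g \<in> G" "mat_cong g M (int (\<Prod>P))" using surj by (auto simp: surj_mod_def)
  have gp: "[g$i$j = M$i$j] (mod int p)" if p: "p \<in> P" for p i j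
  proof -
    have "p dvd \<Prod>P" using dvd_prodI[OF P(1) p, of "\<lambda>x. x"] by simp
    then have "int p dvd int (\<Prod>P)" by (simp only: int_dvd_int_iff)
    then show ?thesis using g(2) by (auto simp: mat_cong_def intro: cong_dvd_modulus)
  qed
  have "slope p g = t p" if p: "p \<in> P" for p
  proof -
    have 1: "[g$2$2 = (if t p = p then 0 else 1)] (mod int p)"
      using cong_trans[OF gp[OF p, of 2 2]] ai[OF p] by (simp add: M)
    have 2: "[g$2$1 = (if t p = p then 1 else int (t p))] (mod int p)"
      using cong_trans[OF gp[OF p, of 2 1]] ci[OF p] by (simp add: M)
    show ?thesis
    proof (cases "t p = p")
      case True
      then show ?thesis using 1 by (simp add: slope_def cong_0_iff)
    next
      case False
      then have lt: "t p < p" using t p by (force simp: PiE_def Pi_def)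
      have g1: "[g$2$2 = 1] (mod int p)" using 1 False by simp
      then have "\<not> int p dvd g$2$2"
        using cong_dvd_iff[OF g1] prime_gt_1_nat[OF P(2)[OF p]] by auto
      moreover have "[g$2$2 * int (t p) = 1 * int (t p)] (mod int p)"
        using g1 by (rule cong_mult) simp
      then have "[g$2$2 * int (t p) = g$2$1] (mod int p)"
        using cong_trans[OF _ cong_sym[OF 2]] False by simp
      ultimately show ?thesis using slope_eqI[OF P(2)[OF p] _ lt] by blast
    qed
  qed
  then have "slopes P g = t" using t by (auto simp: slopes_def fun_eq_iff PiE_def extensional_def)
  then show thesis using that g(1) by blast
qed

text \<open>Cosets are fibres of \<open>slopes P\<close>, and each prime contributes the
  \<open>p + 1\<close> points of its projective line.\<close>

lemma index_Gamma0:
  assumes G: "is_subgroup_SL2 G" and P: "finite P" "\<And>p. p \<in> P \<Longrightarrow> prime p"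
    and surj: "surj_mod G (\<Prod>P)"
  shows "index (Gamma0 G P) G = (\<Prod>p\<in>P. p + 1)"
proof -
  let ?T = "\<Pi>\<^sub>E p\<in>P. {0..p}"
  let ?fib = "\<lambda>t. {x\<in>G. slopes P x = t}"
  have "right_cosets (Gamma0 G P) G = ?fib ` ?T"
  proof (intro equalityI subsetI)
    fix K assume "K \<in> right_cosets (Gamma0 G P) G"
    then obtain g where g: "g \<in> G" "K = (\<lambda>h. h ** g) ` Gamma0 G P" by (auto simp: right_cosets_def)
    then have "K = ?fib (slopes P g)" by (simp only: slopes_fibre[OF G g(1), of P, OF P(2)])
    then show "K \<in> ?fib ` ?T" using slopes_in_PiE[of P g] P(2) by blast
  next
    fix K assume "K \<in> ?fib ` ?T"
    then obtain t where t: "t \<in> ?T" "K = ?fib t" by blast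
    obtain g where g: "g \<in> G" "slopes P g = t" using slopes_surj[OF G P surj t(1)] by blast
    have "K = (\<lambda>h. h ** g) ` Gamma0 G P"
      using slopes_fibre[OF G g(1), of P, OF P(2)] by (simp add: t(2) g(2))
    then show "K \<in> right_cosets (Gamma0 G P) G" using g(1) by (auto simp: right_cosets_def)
  qed
  \<comment> \<open>By transitivity every fibre is nonempty, so distinct tuples give distinct
    cosets.\<close>
  moreover have "inj_on ?fib ?T"
  proof (rule inj_onI)
    fix s t assume s: "s \<in> ?T" and eq: "?fib s = ?fib t"
    obtain g where "g \<in> G" "slopes P g = s" using slopes_surj[OF G P surj s] by blast
    then have "g \<in> ?fib t" unfolding eq[symmetric] by simp
    then show "s = t" using \<open>slopes P g = s\<close> by simp
  qed
  ultimately have "index (Gamma0 G P) G = card ?T" by (simp add: index_def card_image)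
  then show ?thesis using P(1) by (simp add: card_PiE)
qed

section \<open>Infinite sums of finitely supported functions\<close>

lemma infsum_finite_support:
  fixes v :: "'a \<Rightarrow> real"
  assumes "finite S" "\<And>x. x \<in> A \<Longrightarrow> x \<notin> S \<Longrightarrow> v x = 0"
  shows "infsum v A = sum v (A \<inter> S)"
proof -
  have "infsum v A = infsum v (A \<inter> S)" by (rule infsum_cong_neutral) (use assms in auto)
  then show ?thesis using assms(1) by simp
qed

lemma infsum_fibres:
  fixes u :: "'a \<Rightarrow> real"
  assumes "finite S" "\<And>x. x \<in> A \<Longrightarrow> x \<notin> S \<Longrightarrow> u x = 0" "finite T" "\<And>x. x \<in> A \<Longrightarrow> k x \<in> T"
  shows "infsum u A = (\<Sum>t\<in>T. infsum u {x\<in>A. k x = t})"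
proof -
  have fin: "infsum u B = sum u (B \<inter> S)" if "B \<subseteq> A" for B
    by (rule infsum_finite_support[OF assms(1)]) (use that assms(2) in auto)
  have "infsum u A = (\<Sum>t\<in>T. sum u {x \<in> A \<inter> S. k x = t})"
    unfolding fin[OF order_refl] by (rule sum.group[symmetric]) (use assms in auto)
  also have "\<dots> = (\<Sum>t\<in>T. infsum u {x\<in>A. k x = t})"
  proof (rule sum.cong)
    fix t
    have "{x \<in> A \<inter> S. k x = t} = {x\<in>A. k x = t} \<inter> S" by blast
    then show "sum u {x \<in> A \<inter> S. k x = t} = infsum u {x\<in>A. k x = t}" by (simp add: fin)
  qed simp
  finally show ?thesis .
qed

text \<open>The divisibility conditions select \<open>2 ^ card P\<close> tuples of points, and each
  tuple cuts out one right coset of \<open>Gamma0 G P\<close>. Every coset carries the fraction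
  \<open>1 / index\<close> of the total mass up to \<open>E\<close>.\<close>

lemma equidistribution_zeros:
  fixes u :: "imat \<Rightarrow> real"
  assumes G: "is_subgroup_SL2 G" and P: "finite P" "\<And>p. p \<in> P \<Longrightarrow> prime p"
    and odd: "\<And>p. p \<in> P \<Longrightarrow> odd p" and f: "\<And>p. p \<in> P \<Longrightarrow> f = Fz \<Longrightarrow> [p = 1] (mod 4)"
    and surj: "surj_mod G (\<Prod>P)" and w: "w \<in> G"
    and S: "finite S" "\<And>g. g \<in> G \<Longrightarrow> g \<notin> S \<Longrightarrow> u g = 0"
    and equi: "\<And>g0. g0 \<in> G \<Longrightarrow>
      \<bar>(\<Sum>\<^sub>\<infinity>g\<in>Gamma0 G P. u (g ** g0)) - (\<Sum>\<^sub>\<infinity>g\<in>G. u g) / real (index (Gamma0 G P) G)\<bar> \<le> E"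
  shows "\<bar>infsum u {g\<in>G. \<forall>p\<in>P. int p dvd feval f (x0 v* (g ** w))}
           - (\<Prod>p\<in>P. 2 / (real p + 1)) * (\<Sum>\<^sub>\<infinity>g\<in>G. u g)\<bar> \<le> 2 ^ card P * E"
proof -
  let ?A = "{g\<in>G. \<forall>p\<in>P. int p dvd feval f (x0 v* (g ** w))}"
  let ?R = "\<Pi>\<^sub>E p\<in>P. slope_zeros p f"
  let ?I = "(\<Sum>\<^sub>\<infinity>g\<in>G. u g) / real (index (Gamma0 G P) G)"
  have sub: "?R \<subseteq> (\<Pi>\<^sub>E p\<in>P. {0..p})" by (rule PiE_mono) (auto simp: slope_zeros_def)
  have finR: "finite ?R" by (rule finite_PiE[OF P(1)]) (simp add: slope_zeros_def)
  have cardR: "card ?R = 2 ^ card P"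
    using P(1) card_slope_zeros[OF P(2) odd f] by (simp add: card_PiE)
  have fibre: "{x\<in>G. slopes P x = slopes P g} = (\<lambda>h. h ** g) ` Gamma0 G P" if "g \<in> G" for g
    using slopes_fibre[OF G that] P(2) by blast
  have SL: "g \<in> SL2Z" if "g \<in> G" for g using that subgroupD(1)[OF G] by blast
  have zero_iff: "(\<forall>p\<in>P. int p dvd feval f (x0 v* (g ** w))) \<longleftrightarrow> slopes P (g ** w) \<in> ?R"
    if g: "g \<in> G" for g
    using feval_dvd_iff_slope[OF SL[OF subgroupD(3)[OF G g w]] P(2), of _ f]
    by (auto simp: slopes_def PiE_iff)
  have each: "\<bar>infsum u {g\<in>?A. slopes P (g ** w) = t} - ?I\<bar> \<le> E" if t: "t \<in> ?R" for t
  proof -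
    obtain h where h: "h \<in> G" "slopes P h = t" using slopes_surj[OF G P surj] t sub by blast
    \<comment> \<open>Undoing the shift by \<open>w\<close>: the condition that
      \<open>g ** w\<close> lies in the coset of \<open>h\<close> says that \<open>g\<close> lies in
      the coset of \<open>h ** sl2_inv w\<close>.\<close>
    define g0 where "g0 = h ** sl2_inv w"
    have g0: "g0 \<in> G" using h w subgroupD[OF G] by (simp add: g0_def)
    have hw: "h = g0 ** w"
      by (simp add: g0_def sl2_inv_left[OF SL[OF w]] flip: matrix_mul_assoc)
    have "{g\<in>?A. slopes P (g ** w) = t} = (\<lambda>k. k ** g0) ` Gamma0 G P"
    proof (intro equalityI subsetI)
      fix g assume "g \<in> {g\<in>?A. slopes P (g ** w) = t}"
      then have g: "g \<in> G" "slopes P (g ** w) = slopes P h" by (auto simp: h)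
      then have "g ** w \<in> {x\<in>G. slopes P x = slopes P h}" using subgroupD(3)[OF G _ w] by blast
      then obtain k where k: "k \<in> Gamma0 G P" "g ** w = k ** h"
        unfolding fibre[OF h(1)] by blast
      then have "(\<lambda>x. x ** w) g = (\<lambda>x. x ** w) (k ** g0)" by (simp add: hw matrix_mul_assoc)
      then have "g = k ** g0" using inj_mult_right[OF SL[OF w], of UNIV] by (auto dest: injD)
      then show "g \<in> (\<lambda>k. k ** g0) ` Gamma0 G P" using k by blast
    next
      fix g assume "g \<in> (\<lambda>k. k ** g0) ` Gamma0 G P"
      then obtain k where k: "k \<in> Gamma0 G P" "g = k ** g0" by blast
      have gG: "g \<in> G" using k g0 Gamma0_subset subgroupD[OF G] by blast
      have "g ** w = k ** h" by (simp add: k hw matrix_mul_assoc)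
      then have "g ** w \<in> {x\<in>G. slopes P x = slopes P h}"
        unfolding fibre[OF h(1)] using k(1) by blast
      then have "slopes P (g ** w) = t" by (simp add: h)
      then show "g \<in> {g\<in>?A. slopes P (g ** w) = t}" using gG zero_iff[OF gG] t by simp
    qed
    then have "infsum u {g\<in>?A. slopes P (g ** w) = t} = (\<Sum>\<^sub>\<infinity>g\<in>Gamma0 G P. u (g ** g0))"
      using infsum_reindex[OF inj_mult_right[OF SL[OF g0]], of u "Gamma0 G P"] by (simp add: o_def)
    then show ?thesis using equi[OF g0] by simp
  qed
  have "infsum u ?A = (\<Sum>t\<in>?R. infsum u {g\<in>?A. slopes P (g ** w) = t})"
    by (rule infsum_fibres[OF S(1) _ finR]) (use S(2) zero_iff in auto)
  moreover have "(\<Prod>p\<in>P. 2 / (real p + 1)) * (\<Sum>\<^sub>\<infinity>g\<in>G. u g) = (\<Sum>t\<in>?R. ?I)"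
    by (simp add: cardR index_Gamma0[OF G P surj] prod_dividef add.commute)
  ultimately have "infsum u ?A - (\<Prod>p\<in>P. 2 / (real p + 1)) * (\<Sum>\<^sub>\<infinity>g\<in>G. u g)
      = (\<Sum>t\<in>?R. infsum u {g\<in>?A. slopes P (g ** w) = t} - ?I)" by (simp add: sum_subtractf)
  also have "\<bar>\<dots>\<bar> \<le> (\<Sum>t\<in>?R. E)" using each by (intro order_trans[OF sum_abs] sum_mono)
  finally show ?thesis by (simp add: cardR)
qed

text \<open>Expanding the product over subsets \<open>D\<close> of \<open>P\<close> leaves pure
  divisibility conditions. The set \<open>D\<close> contributes an error of at most
  \<open>2 ^ card D * E\<close> times the product of \<open>r\<close> over \<open>P - D\<close>;
  these add up to the product of \<open>2 + r p\<close>, times \<open>E\<close>, and each factor is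
  at most 3.\<close>

lemma equidistribution_sieve_weight:
  fixes u :: "imat \<Rightarrow> real" and r :: "nat \<Rightarrow> real"
  assumes G: "is_subgroup_SL2 G" and P: "finite P" "\<And>p. p \<in> P \<Longrightarrow> prime p"
    and odd: "\<And>p. p \<in> P \<Longrightarrow> odd p" and f: "\<And>p. p \<in> P \<Longrightarrow> f = Fz \<Longrightarrow> [p = 1] (mod 4)"
    and r: "\<And>p. p \<in> P \<Longrightarrow> 0 \<le> r p \<and> r p \<le> 1"
    and surj: "\<And>D. D \<subseteq> P \<Longrightarrow> surj_mod G (\<Prod>D)" and w: "w \<in> G"
    and S: "finite S" "\<And>g. g \<in> G \<Longrightarrow> g \<notin> S \<Longrightarrow> u g = 0"
    and equi: "\<And>D g0. D \<subseteq> P \<Longrightarrow> g0 \<in> G \<Longrightarrow>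
      \<bar>(\<Sum>\<^sub>\<infinity>g\<in>Gamma0 G D. u (g ** g0)) - (\<Sum>\<^sub>\<infinity>g\<in>G. u g) / real (index (Gamma0 G D) G)\<bar> \<le> E"
  shows "\<bar>(\<Sum>\<^sub>\<infinity>g\<in>G. u g * (\<Prod>p\<in>P. (if int p dvd feval f (x0 v* (g ** w)) then 1 else 0) - r p))
           - (\<Prod>p\<in>P. 2 / (real p + 1) - r p) * (\<Sum>\<^sub>\<infinity>g\<in>G. u g)\<bar> \<le> 3 ^ card P * E"
proof -
  let ?i = "\<lambda>g p. if int p dvd feval f (x0 v* (g ** w)) then 1 else 0 :: real"
  let ?c = "\<lambda>D. \<Prod>p\<in>P - D. - r p"
  let ?A = "\<lambda>D. {g\<in>G. \<forall>p\<in>D. int p dvd feval f (x0 v* (g ** w))}"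
  let ?b = "\<lambda>D. \<Prod>p\<in>D. 2 / (real p + 1)"
  let ?S = "\<Sum>\<^sub>\<infinity>g\<in>G. u g"
  \<comment> \<open>The error bound at the empty set of primes dominates an absolute value.\<close>
  have E: "0 \<le> E" using order_trans[OF abs_ge_zero equi[of "{}" w]] w by simp
  have fD: "finite D" if "D \<in> Pow P" for D using that P(1) finite_subset by blast
  have ind: "u g * (\<Prod>p\<in>D. ?i g p) = (if g \<in> ?A D then u g else 0)"
    if "D \<in> Pow P" "g \<in> G" for D g
  proof -
    have "(\<Prod>p\<in>D. ?i g p) = (if \<forall>p\<in>D. int p dvd feval f (x0 v* (g ** w)) then 1 else 0)"
      using fD[OF that(1)] by (auto intro!: prod.neutral)
    then show ?thesis using that(2) by simp
  qed
  have infA: "infsum u (?A D) = (\<Sum>g\<in>G \<inter> S. if g \<in> ?A D then u g else 0)" for D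
  proof -
    have "infsum u (?A D) = infsum (\<lambda>g. if g \<in> ?A D then u g else 0) (G \<inter> S)"
      by (rule infsum_cong_neutral) (use S(2) in auto)
    then show ?thesis using S(1) by simp
  qed
  have "(\<Sum>\<^sub>\<infinity>g\<in>G. u g * (\<Prod>p\<in>P. ?i g p - r p)) = (\<Sum>g\<in>G \<inter> S. u g * (\<Prod>p\<in>P. ?i g p - r p))"
    by (rule infsum_finite_support[OF S(1)]) (use S(2) in auto)
  also have "\<dots> = (\<Sum>g\<in>G \<inter> S. \<Sum>D\<in>Pow P. ?c D * (u g * (\<Prod>p\<in>D. ?i g p)))"
    unfolding diff_conv_add_uminus prod_add[OF P(1)] by (simp add: sum_distrib_left mult_ac)
  also have "\<dots> = (\<Sum>D\<in>Pow P. ?c D * (\<Sum>g\<in>G \<inter> S. u g * (\<Prod>p\<in>D. ?i g p)))"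
    unfolding sum_distrib_left by (rule sum.swap)
  also have "\<dots> = (\<Sum>D\<in>Pow P. ?c D * infsum u (?A D))"
  proof (rule sum.cong[OF refl])
    fix D assume "D \<in> Pow P"
    then have "(\<Sum>g\<in>G \<inter> S. u g * (\<Prod>p\<in>D. ?i g p)) = infsum u (?A D)"
      unfolding infA using ind by (intro sum.cong) blast+
    then show "?c D * (\<Sum>g\<in>G \<inter> S. u g * (\<Prod>p\<in>D. ?i g p)) = ?c D * infsum u (?A D)" by simp
  qed
  finally have lhs: "(\<Sum>\<^sub>\<infinity>g\<in>G. u g * (\<Prod>p\<in>P. ?i g p - r p)) = (\<Sum>D\<in>Pow P. ?c D * infsum u (?A D))" .
  have "(\<Prod>p\<in>P. 2 / (real p + 1) - r p) * ?S = (\<Sum>D\<in>Pow P. ?c D * (?b D * ?S))"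
    unfolding diff_conv_add_uminus prod_add[OF P(1)] by (simp add: sum_distrib_left mult_ac)
  then have "(\<Sum>\<^sub>\<infinity>g\<in>G. u g * (\<Prod>p\<in>P. ?i g p - r p)) - (\<Prod>p\<in>P. 2 / (real p + 1) - r p) * ?S
     = (\<Sum>D\<in>Pow P. ?c D * (infsum u (?A D) - ?b D * ?S))"
    unfolding lhs by (simp add: sum_subtractf right_diff_distrib)
  also have "\<bar>\<dots>\<bar> \<le> (\<Sum>D\<in>Pow P. (\<Prod>p\<in>P - D. r p) * (2 ^ card D * E))"
  proof (intro order_trans[OF sum_abs] sum_mono)
    fix D assume D: "D \<in> Pow P"
    then have DP: "D \<subseteq> P" by simp
    have "\<bar>?c D\<bar> = (\<Prod>p\<in>P - D. r p)"
      using r by (auto simp: abs_prod intro!: prod.cong)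
    moreover have "\<bar>infsum u (?A D) - ?b D * ?S\<bar> \<le> 2 ^ card D * E"
      using DP by (intro equidistribution_zeros[OF G fD[OF D] _ _ _ surj[OF DP] w S] equi)
        (use P odd f in auto)
    ultimately show "\<bar>?c D * (infsum u (?A D) - ?b D * ?S)\<bar> \<le> (\<Prod>p\<in>P - D. r p) * (2 ^ card D * E)"
      unfolding abs_mult using r by (intro mult_mono) (auto intro!: prod_nonneg)
  qed
  also have "\<dots> = (\<Prod>p\<in>P. 2 + r p) * E"
    unfolding prod_add[OF P(1)] by (simp add: sum_distrib_left mult_ac)
  also have "(\<Prod>p\<in>P. 2 + r p) \<le> (\<Prod>p\<in>P. 3)" using r by (intro prod_mono) auto
  then have "(\<Prod>p\<in>P. 2 + r p) * E \<le> 3 ^ card P * E" using E by (simp add: mult_right_mono)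
  finally show ?thesis .
qed

subsection \<open>Local densities\<close>

lemma prime_factors_prod_primes:
  fixes Y :: "nat set"
  assumes "finite Y" "\<And>p. p \<in> Y \<Longrightarrow> prime p"
  shows "prime_factors (\<Prod>Y) = Y"
proof -
  have "prime_factors (\<Prod>p\<in>Y. p) = \<Union> ((prime_factors \<circ> (\<lambda>p. p)) ` Y)"
    using assms by (intro prime_factors_prod) (auto dest: prime_gt_0_nat)
  also have "\<dots> = Y" using assms(2) by (auto simp: prime_prime_factors)
  finally show ?thesis by simp
qed

lemma squarefree_prod_primes:
  fixes Y :: "nat set"
  assumes "\<And>p. p \<in> Y \<Longrightarrow> prime p"
  shows "squarefree (\<Prod>Y)"
  using assms by (intro squarefree_prod_coprime) (auto intro: primes_coprime squarefree_prime)

lemma squarefree_pos: "squarefree (n::nat) \<Longrightarrow> n > 0"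
  by (rule gr0I) simp

lemma prod_prime_factors_squarefree:
  assumes "squarefree (n::nat)"
  shows "\<Prod>(prime_factors n) = n"
proof -
  have n: "n \<noteq> 0" using squarefree_pos[OF assms] by simp
  have "(\<Prod>p\<in>prime_factors n. p ^ multiplicity p n) = (\<Prod>p\<in>prime_factors n. p)"
  proof (rule prod.cong[OF refl])
    fix p assume "p \<in> prime_factors n"
    then show "p ^ multiplicity p n = p"
      using assms n squarefree_factorial_semiring'[of n] by auto
  qed
  then show ?thesis using prod_prime_factors[OF n] by simp
qed

lemma rho_nonneg: "0 \<le> rho n"
  by (auto simp: rho_def intro!: prod_nonneg divide_nonneg_nonneg dest!: in_prime_factors_imp_prime prime_ge_1_nat)

lemma rho_prime: "prime p \<Longrightarrow> rho p = (2 * real p - 1) / (real p)\<^sup>2"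
  by (simp add: rho_def squarefree_prime prime_prime_factors)

lemma rho_squarefree: "squarefree n \<Longrightarrow> rho n = (\<Prod>p\<in>prime_factors n. rho p)"
  by (subst rho_def) (auto simp: rho_prime in_prime_factors_imp_prime intro!: prod.cong)

lemma rho_prime_le:
  assumes "prime p" shows "rho p \<le> 1" "rho p \<le> 2 / real p"
proof -
  have p: "real p \<ge> 2" using prime_ge_2_nat[OF assms] by simp
  \<comment> \<open>Expanded, this is \<open>2 * p - 1 <= p^2\<close>.\<close>
  have "0 \<le> (real p - 1)\<^sup>2" by simp
  then show "rho p \<le> 1" unfolding rho_prime[OF assms] using p
    by (simp add: divide_simps power2_eq_square algebra_simps)
  show "rho p \<le> 2 / real p" unfolding rho_prime[OF assms] using p
    by (simp add: divide_simps power2_eq_square algebra_simps)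
qed

lemma rho_le:
  assumes "squarefree n" shows "rho n \<le> 2 ^ card (prime_factors n) / real n"
proof -
  have "rho n \<le> (\<Prod>p\<in>prime_factors n. 2 / real p)"
    unfolding rho_squarefree[OF assms] using rho_nonneg rho_prime_le(2) by (intro prod_mono) auto
  also have "\<dots> = 2 ^ card (prime_factors n) / real (\<Prod>(prime_factors n))"
    by (simp add: prod_dividef)
  finally show ?thesis by (simp only: prod_prime_factors_squarefree[OF assms])
qed

text \<open>The density of the sieve weight \<open>\<Xi>(q; \<cdot>)\<close> on the projective line modulo \<open>q\<close>.\<close>
definition gap :: "nat \<Rightarrow> quad_form \<Rightarrow> nat \<Rightarrow> real" where
  "gap B f q = (\<Prod>p\<in>prime_factors q. beta_p B f p - rho p)"

text \<open>A Dirichlet convolution read prime by prime: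
  \<open>beta_p = (beta_p - rho) + rho\<close>, and expanding the product over subsets of the prime
  factors is summing over divisors. It supplies the main term once the sum over \<open>q\<close> is
  completed.\<close>

lemma sum_rho_gap:
  assumes sf: "squarefree n"
  shows "(\<Sum>q | q dvd n. rho (n div q) * gap B f q) = beta B f n"
proof -
  let ?P = "prime_factors n"
  have n: "n \<noteq> 0" using squarefree_pos[OF sf] by simp
  have prod_split: "\<Prod>X * \<Prod>(?P - X) = n" if "X \<subseteq> ?P" for X
    using prod.subset_diff[OF that, of "\<lambda>p. p"] prod_prime_factors_squarefree[OF sf]
    by (simp add: mult.commute)
  have pos: "\<Prod>X > 0" if "X \<subseteq> ?P" for X
    using that by (intro prod_pos) (auto dest!: in_prime_factors_imp_prime prime_gt_0_nat)
  have fX: "finite X" if "X \<subseteq> ?P" for X using that finite_subset by blast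
  have "beta B f n = (\<Prod>p\<in>?P. (beta_p B f p - rho p) + rho p)" using sf by (simp add: beta_def)
  also have "\<dots> = (\<Sum>X\<in>Pow ?P. (\<Prod>p\<in>X. beta_p B f p - rho p) * (\<Prod>p\<in>?P - X. rho p))"
    by (rule prod_add) simp
  also have "\<dots> = (\<Sum>q | q dvd n. rho (n div q) * gap B f q)"
  proof (rule sum.reindex_bij_witness[of _ prime_factors "\<lambda>X. \<Prod>X"])
    fix X assume "X \<in> Pow ?P"
    then have X: "X \<subseteq> ?P" by simp
    show pf: "prime_factors (\<Prod>X) = X"
      using fX[OF X] X by (intro prime_factors_prod_primes) auto
    have "\<Prod>X dvd n" using prod_split[OF X] by (metis dvd_triv_left)
    then show "\<Prod>X \<in> {q. q dvd n}" by simp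
    have "n div \<Prod>X = \<Prod>(?P - X)"
      using prod_split[OF X] pos[OF X] by (metis nonzero_mult_div_cancel_left less_irrefl)
    moreover have "prime_factors (\<Prod>(?P - X)) = ?P - X" "squarefree (\<Prod>(?P - X))"
      by (auto intro!: prime_factors_prod_primes squarefree_prod_primes)
    ultimately show "rho (n div \<Prod>X) * gap B f (\<Prod>X)
        = (\<Prod>p\<in>X. beta_p B f p - rho p) * (\<Prod>p\<in>?P - X. rho p)"
      by (simp add: gap_def pf rho_squarefree mult.commute)
  next
    fix q assume "q \<in> {q. q dvd n}"
    then have q: "q dvd n" by simp
    show "\<Prod>(prime_factors q) = q"
      using prod_prime_factors_squarefree squarefree_mono[OF q sf] by blast
    show "prime_factors q \<in> Pow ?P" using q n by (simp add: dvd_prime_factors)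
  qed
  finally show ?thesis ..
qed

text \<open>The terms of order \<open>1 / p\<close> cancel:
  \<open>2 / (p + 1) - (2 * p - 1) / p^2\<close> equals \<open>(1 - p) / ((p + 1) * p^2)\<close>.
  The resulting square decay makes the tail over large \<open>q\<close> small.\<close>

lemma abs_gap_le:
  assumes sf: "squarefree q" and b: "\<And>p. p \<in> prime_factors q \<Longrightarrow> beta_p B f p = 2 / (real p + 1)"
  shows "\<bar>gap B f q\<bar> \<le> 1 / (real q)\<^sup>2"
proof -
  have "\<bar>gap B f q\<bar> \<le> (\<Prod>p\<in>prime_factors q. 1 / (real p)\<^sup>2)"
    unfolding gap_def abs_prod
  proof (intro prod_mono conjI)
    fix p assume p: "p \<in> prime_factors q"
    have p2: "real p \<ge> 2" using prime_ge_2_nat[of p] p by auto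
    have "2 / (real p + 1) - (2 * real p - 1) / (real p)\<^sup>2 = (1 - real p) / (real p + 1) / (real p)\<^sup>2"
      using p2 by (simp add: divide_simps power2_eq_square) (simp add: algebra_simps)
    then have "\<bar>beta_p B f p - rho p\<bar> = \<bar>(1 - real p) / (real p + 1)\<bar> / (real p)\<^sup>2"
      using p by (simp add: b rho_prime in_prime_factors_imp_prime)
    moreover have "\<bar>(1 - real p) / (real p + 1)\<bar> \<le> 1" using p2 by (simp add: divide_simps)
    ultimately show "\<bar>beta_p B f p - rho p\<bar> \<le> 1 / (real p)\<^sup>2"
      by (simp only: divide_right_mono zero_le_power2)
  qed simp
  also have "\<dots> = 1 / (real (\<Prod>(prime_factors q)))\<^sup>2"
    by (simp add: prod_dividef prod_power_distrib)
  finally show ?thesis by (simp only: prod_prime_factors_squarefree[OF sf])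
qed

subsection \<open>Divisor sums\<close>

text \<open>Primes above \<open>N\<close> satisfy \<open>3 <= p powr \<epsilon>\<close> and pay for
  their own factor 3; at most \<open>N\<close> primes remain, which cost the constant
  \<open>3 ^ N\<close>.\<close>

lemma three_pow_omega_le:
  fixes \<epsilon> :: real
  assumes "\<epsilon> > 0"
  obtains C where "C \<ge> 0" "\<And>n. squarefree n \<Longrightarrow> 3 ^ card (prime_factors n) \<le> C * real n powr \<epsilon>"
proof -
  define N where "N = nat \<lceil>3 powr (1 / \<epsilon>)\<rceil>"
  have "3 ^ card (prime_factors n) \<le> 3 ^ N * real n powr \<epsilon>" if sf: "squarefree n" for n
  proof -
    let ?P = "prime_factors n"
    have "(3::real) ^ card ?P = (\<Prod>p\<in>?P. 3)" by simp
    also have "\<dots> \<le> (\<Prod>p\<in>?P. (if p \<le> N then 3 else 1) * real p powr \<epsilon>)"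
    proof (intro prod_mono conjI)
      fix p assume p: "p \<in> ?P"
      have p1: "real p \<ge> 1" using prime_ge_1_nat[of p] p by auto
      show "3 \<le> (if p \<le> N then 3 else 1) * real p powr \<epsilon>"
      proof (cases "p \<le> N")
        case True then show ?thesis using p1 assms by (simp add: ge_one_powr_ge_zero)
      next
        case False
        then have "3 powr (1 / \<epsilon>) \<le> real p" unfolding N_def by linarith
        then have "(3 powr (1 / \<epsilon>)) powr \<epsilon> \<le> real p powr \<epsilon>" using assms by (intro powr_mono2) auto
        then show ?thesis using False assms by (simp add: powr_powr)
      qed
    qed simp
    also have "\<dots> = (\<Prod>p\<in>?P. if p \<le> N then 3 else 1) * (\<Prod>p\<in>?P. real p powr \<epsilon>)"
      by (rule prod.distrib)
    also have "(\<Prod>p\<in>?P. real p powr \<epsilon>) = real (\<Prod>?P) powr \<epsilon>"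
      by (simp add: prod_powr_distrib)
    also have "\<Prod>?P = n" by (rule prod_prime_factors_squarefree[OF sf])
    also have "(\<Prod>p\<in>?P. if p \<le> N then 3 else (1::real)) = 3 ^ card {p\<in>?P. p \<le> N}"
      by (simp add: prod.If_cases Int_def)
    also have "card {p\<in>?P. p \<le> N} \<le> card {1..N}"
      by (intro card_mono) (auto dest!: in_prime_factors_imp_prime prime_ge_1_nat)
    then have "(3::real) ^ card {p\<in>?P. p \<le> N} * real n powr \<epsilon> \<le> 3 ^ N * real n powr \<epsilon>"
      by (intro mult_right_mono power_increasing) auto
    finally show ?thesis .
  qed
  then show thesis using that[of "3 ^ N"] by simp
qed

text \<open>For \<open>m < Q\<close> the term \<open>1 / m\<close> is at most
  \<open>m powr (- 1 - \<epsilon>) * Q powr \<epsilon>\<close>, and the series of the first factor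
  converges.\<close>

lemma sum_inverse_le_powr:
  fixes \<epsilon> :: real
  assumes "\<epsilon> > 0"
  obtains C where "C \<ge> 0" "\<And>Q. (\<Sum>m | 1 \<le> m \<and> real m < Q. 1 / real m) \<le> C * Q powr \<epsilon>"
proof -
  let ?f = "\<lambda>m. real m powr (- 1 - \<epsilon>)"
  have sm: "summable ?f" using assms by (subst summable_real_powr_iff) auto
  have "(\<Sum>m | 1 \<le> m \<and> real m < Q. 1 / real m) \<le> suminf ?f * Q powr \<epsilon>" for Q
  proof -
    have "{m. 1 \<le> m \<and> real m < Q} \<subseteq> {..nat \<lceil>Q\<rceil>}" by auto linarith
    then have fin: "finite {m. 1 \<le> m \<and> real m < Q}" by (rule finite_subset) simp
    have "(\<Sum>m | 1 \<le> m \<and> real m < Q. 1 / real m) \<le> (\<Sum>m | 1 \<le> m \<and> real m < Q. ?f m * Q powr \<epsilon>)"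
    proof (rule sum_mono)
      fix m assume m: "m \<in> {m. 1 \<le> m \<and> real m < Q}"
      then have "1 / real m = ?f m * real m powr \<epsilon>"
        by (simp add: powr_minus_divide flip: powr_add)
      also have "\<dots> \<le> ?f m * Q powr \<epsilon>" using m assms by (intro mult_left_mono powr_mono2) auto
      finally show "1 / real m \<le> ?f m * Q powr \<epsilon>" .
    qed
    also have "\<dots> = (\<Sum>m | 1 \<le> m \<and> real m < Q. ?f m) * Q powr \<epsilon>" by (simp add: sum_distrib_right)
    also have "\<dots> \<le> suminf ?f * Q powr \<epsilon>"
      by (intro mult_right_mono sum_le_suminf sm fin) auto
    finally show ?thesis .
  qed
  then show thesis using that[of "suminf ?f"] suminf_nonneg[OF sm] by simp
qed

lemma sum_inverse_squares_le:
  fixes Q0 :: real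
  assumes "Q0 > 0"
  shows "(\<Sum>q | Q0 \<le> real q \<and> real q < Q. 1 / (real q)\<^sup>2) \<le> 2 / Q0"
proof -
  define N where "N = nat \<lceil>Q0\<rceil>"
  \<comment> \<open>Taking the maximum ensures \<open>N <= M\<close> even when the range of
    summation is empty.\<close>
  define M where "M = max N (nat \<lceil>Q\<rceil>)"
  have N: "real N \<ge> Q0" "N \<ge> 1" using assms unfolding N_def by linarith+
  have sub: "{q. Q0 \<le> real q \<and> real q < Q} \<subseteq> {N..<M}"
    unfolding N_def M_def by auto linarith+
  \<comment> \<open>Telescoping: \<open>1 / K^2 <= 2 / K - 2 / (K + 1)\<close> amounts to
    \<open>K + 1 <= 2 * K\<close>, so the factor 2 makes it valid from \<open>K = 1\<close>
    on.\<close>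
  have tele: "(\<Sum>q = N..<K. 1 / (real q)\<^sup>2) \<le> 2 / real N - 2 / real K" if "N \<le> K" for K
    using that
  proof (induction K rule: dec_induct)
    case (step K)
    have K: "real K \<ge> 1" using step N by simp
    have "1 / (real K)\<^sup>2 \<le> 2 / real K - 2 / real (Suc K)"
      using K by (simp add: divide_simps power2_eq_square)
    then show ?case using step by simp
  qed simp
  have "(\<Sum>q | Q0 \<le> real q \<and> real q < Q. 1 / (real q)\<^sup>2) \<le> (\<Sum>q = N..<M. 1 / (real q)\<^sup>2)"
    by (rule sum_mono2[OF _ sub]) auto
  also have "\<dots> \<le> 2 / real N - 2 / real M" using tele[of M] by (simp add: M_def)
  also have "\<dots> \<le> 2 / real N" by simp
  also have "\<dots> \<le> 2 / Q0" using N assms by (simp add: frac_le)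
  finally show ?thesis .
qed

text \<open>Starting the count at 1 avoids an additive 1, so the bound also holds for
  \<open>Q0 < 1\<close>.\<close>

lemma card_nat_less_real_le:
  assumes "(Q0::real) \<ge> 0"
  shows "real (card {q. 1 \<le> q \<and> real q < Q0}) \<le> Q0"
proof -
  have "{q. 1 \<le> q \<and> real q < Q0} \<subseteq> {1..nat \<lfloor>Q0\<rfloor>}" by (auto simp: le_nat_floor)
  then have "card {q. 1 \<le> q \<and> real q < Q0} \<le> nat \<lfloor>Q0\<rfloor>"
    using card_mono[of "{1..nat \<lfloor>Q0\<rfloor>}"] by fastforce
  then show ?thesis using assms by linarith
qed

text \<open>The divisor sums are opened by writing a modulus as \<open>n = q m\<close> and summing over \<open>q\<close> and \<open>m\<close>
  independently.\<close>
lemma sum_divisors_le: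
  fixes \<epsilon> :: real
  assumes "\<epsilon> > 0"
  obtains C where "C \<ge> 0"
    "\<And>A R (w :: nat \<Rightarrow> real) (Q :: real). Q \<ge> 1 \<Longrightarrow> (\<And>n. n \<in> A \<Longrightarrow> squarefree n \<and> real n < Q) \<Longrightarrow> (\<And>q. 0 \<le> w q) \<Longrightarrow>
      (\<Sum>n\<in>A. \<Sum>q | q dvd n \<and> R q. 3 ^ card (prime_factors n) / real (n div q) * w q)
        \<le> C * Q powr \<epsilon> * (\<Sum>q | 1 \<le> q \<and> real q < Q \<and> R q. w q)"
proof -
  \<comment> \<open>One half of the exponent pays for \<open>3 ^ card (prime_factors n)\<close>, the
    other for the sum of \<open>1 / m\<close>.\<close>
  have e2: "\<epsilon> / 2 > 0" using assms by simp
  obtain C1 where C1: "C1 \<ge> 0" "\<And>n. squarefree n \<Longrightarrow> 3 ^ card (prime_factors n) \<le> C1 * real n powr (\<epsilon> / 2)"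
    using three_pow_omega_le[OF e2] by blast
  obtain C2 where C2: "C2 \<ge> 0" "\<And>Q. (\<Sum>m | 1 \<le> m \<and> real m < Q. 1 / real m) \<le> C2 * Q powr (\<epsilon> / 2)"
    using sum_inverse_le_powr[OF e2] by blast
  show thesis
  proof (rule that[of "C1 * C2"])
    show "C1 * C2 \<ge> 0" using C1 C2 by simp
    fix A R and w :: "nat \<Rightarrow> real" and Q :: real
    assume Q: "Q \<ge> 1" and A: "\<And>n. n \<in> A \<Longrightarrow> squarefree n \<and> real n < Q" and w: "\<And>q. 0 \<le> w q"
    let ?K = "C1 * Q powr (\<epsilon> / 2)"
    let ?B = "{q. 1 \<le> q \<and> real q < Q \<and> R q}" and ?M = "{m. 1 \<le> m \<and> real m < Q}"
    let ?h = "\<lambda>(q, m). ?K * (1 / real m * w q)"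
    have bd: "m \<in> {..nat \<lceil>Q\<rceil>}" if "real m < Q" for m using that by simp linarith
    have fin: "finite A" "finite ?B" "finite ?M"
      by (rule finite_subset[OF _ finite_atMost[of "nat \<lceil>Q\<rceil>"]], use A bd in blast)+
    have dv: "1 \<le> q \<and> q \<le> n \<and> 1 \<le> n div q \<and> n div q \<le> n" if "n \<in> A" "q dvd n" for n q
    proof -
      have "n > 0" using A[OF that(1)] squarefree_pos by blast
      then show ?thesis using that(2) by (auto dest: dvd_imp_le simp: Suc_le_eq div_greater_zero_iff intro: Nat.gr0I)
    qed
    let ?D = "\<lambda>n. {q. q dvd n \<and> R q}"
    have finD: "finite (?D n)" if "n \<in> A" for n
      by (rule finite_subset[OF _ finite_atMost[of n]]) (use dv[OF that] in auto)
    have "(\<Sum>n\<in>A. \<Sum>q\<in>?D n. 3 ^ card (prime_factors n) / real (n div q) * w q)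
        \<le> (\<Sum>n\<in>A. \<Sum>q\<in>?D n. ?h (q, n div q))"
    proof (intro sum_mono)
      fix n q assume n: "n \<in> A" and q: "q \<in> ?D n"
      have "3 ^ card (prime_factors n) \<le> C1 * real n powr (\<epsilon> / 2)" using C1(2) A[OF n] by blast
      also have "\<dots> \<le> ?K" using A[OF n] C1(1) assms by (intro mult_left_mono powr_mono2) auto
      finally have "3 ^ card (prime_factors n) * (1 / real (n div q) * w q) \<le> ?K * (1 / real (n div q) * w q)"
        using w by (intro mult_right_mono) auto
      then show "3 ^ card (prime_factors n) / real (n div q) * w q \<le> ?h (q, n div q)" by simp
    qed
    also have "\<dots> = (\<Sum>(n, q)\<in>Sigma A ?D. ?h (q, n div q))"
      using fin finD by (subst sum.Sigma) auto
    also have "\<dots> = sum (?h \<circ> (\<lambda>(n, q). (q, n div q))) (Sigma A ?D)"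
      by (rule sum.cong) auto
    also have "\<dots> = sum ?h ((\<lambda>(n, q). (q, n div q)) ` Sigma A ?D)"
    proof (rule sum.reindex[symmetric])
      \<comment> \<open>The modulus is recovered as \<open>n = q * (n div q)\<close> because
        \<open>q\<close> divides \<open>n\<close>.\<close>
      show "inj_on (\<lambda>(n, q). (q, n div q)) (Sigma A ?D)"
        by (rule inj_on_inverseI[where g = "\<lambda>(q, m). (q * m, q)"]) auto
    qed
    \<comment> \<open>Nonnegativity of the terms allows dropping the condition that
      \<open>q * m\<close> lies in \<open>A\<close>, which decouples the two variables.\<close>
    also have "\<dots> \<le> sum ?h (?B \<times> ?M)"
    proof (rule sum_mono2)
      show "finite (?B \<times> ?M)" using fin by simp
      show "(\<lambda>(n, q). (q, n div q)) ` Sigma A ?D \<subseteq> ?B \<times> ?M"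
        using dv A by (auto; meson le_less_trans of_nat_le_iff)
      show "0 \<le> ?h x" for x using w C1(1) by (cases x) auto
    qed
    also have "\<dots> = (\<Sum>m\<in>?M. \<Sum>q\<in>?B. ?K * (1 / real m * w q))"
      unfolding sum.cartesian_product[symmetric] by (rule sum.swap)
    also have "\<dots> = ?K * ((\<Sum>m\<in>?M. 1 / real m) * (\<Sum>q\<in>?B. w q))"
      unfolding sum_product by (simp only: sum_distrib_left)
    also have "\<dots> \<le> ?K * ((C2 * Q powr (\<epsilon> / 2)) * (\<Sum>q\<in>?B. w q))"
      using C1(1) C2(2) w by (intro mult_left_mono mult_right_mono sum_nonneg) auto
    also have "\<dots> = C1 * C2 * (Q powr (\<epsilon> / 2) * Q powr (\<epsilon> / 2)) * (\<Sum>q\<in>?B. w q)" by simp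
    also have "Q powr (\<epsilon> / 2) * Q powr (\<epsilon> / 2) = Q powr \<epsilon>" by (simp flip: powr_add)
    finally show "(\<Sum>n\<in>A. \<Sum>q\<in>?D n. 3 ^ card (prime_factors n) / real (n div q) * w q)
        \<le> C1 * C2 * Q powr \<epsilon> * (\<Sum>q\<in>?B. w q)" .
  qed
qed

text \<open>Every entry is bounded by the norm. This gives \<open>Ups X\<close> finite support, so
  its infinite sums are finite ones.\<close>

lemma finite_mnorm_le: "finite {A. mnorm A \<le> R}"
proof -
  define N where "N = \<lceil>\<bar>R\<bar>\<rceil>"
  let ?f = "\<lambda>(a, b, c, d). vector [vector [a, b], vector [c, d]] :: imat"
  have "{A. mnorm A \<le> R} \<subseteq> ?f ` ({-N..N} \<times> {-N..N} \<times> {-N..N} \<times> {-N..N})"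
  proof
    fix A assume "A \<in> {A. mnorm A \<le> R}"
    then have A: "mnorm A \<le> R" by simp
    have e: "A$i$j \<in> {-N..N}" for i j
    proof -
      have "(real_of_int (A$i$j))\<^sup>2 \<le> (\<Sum>j\<in>UNIV. (real_of_int (A$i$j))\<^sup>2)"
        by (rule member_le_sum) auto
      also have "\<dots> \<le> (\<Sum>i\<in>UNIV. \<Sum>j\<in>UNIV. (real_of_int (A$i$j))\<^sup>2)"
        by (rule member_le_sum[where f = "\<lambda>i. \<Sum>j\<in>UNIV. (real_of_int (A$i$j))\<^sup>2"]) (auto intro: sum_nonneg)
      finally have "\<bar>real_of_int (A$i$j)\<bar> \<le> mnorm A" unfolding mnorm_def by (rule real_le_rsqrt[of "\<bar>_\<bar>", unfolded power2_abs])
      then show ?thesis using A unfolding N_def by (simp; linarith)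
    qed
    have "A = ?f (A$1$1, A$1$2, A$2$1, A$2$2)" by (simp add: imat_eq_iff)
    then show "A \<in> ?f ` ({-N..N} \<times> {-N..N} \<times> {-N..N} \<times> {-N..N})" using e by blast
  qed
  then show ?thesis by (rule finite_subset) simp
qed

subsection \<open>The main term for a single modulus\<close>

lemma card_prime_factors_squarefree_mult:
  assumes "squarefree (a * b :: nat)"
  shows "card (prime_factors (a * b)) = card (prime_factors a) + card (prime_factors b)"
proof -
  have nz: "a \<noteq> 0" "b \<noteq> 0" using squarefree_pos[OF assms] by auto
  have "prime_factors a \<inter> prime_factors b = {}"
  proof (rule ccontr)
    assume "prime_factors a \<inter> prime_factors b \<noteq> {}"
    then obtain p where p: "prime p" "p dvd a" "p dvd b"
      by (auto simp: in_prime_factors_iff)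
    then have "p\<^sup>2 dvd a * b" unfolding power2_eq_square by (intro mult_dvd_mono)
    then show False using squarefreeD[OF assms] p(1) not_prime_unit by blast
  qed
  then show ?thesis using nz by (simp add: prime_factorization_mult card_Un_disjoint)
qed

text \<open>The prime factors of \<open>n\<close> split between \<open>q\<close> and
  \<open>n div q\<close>. Enlarging the \<open>2\<close> in the bound for \<open>rho\<close> to
  \<open>3\<close> merges both powers into one that no longer depends on \<open>q\<close>.\<close>

lemma rho_cofactor_le:
  assumes sf: "squarefree n" and q: "q dvd n"
  shows "rho (n div q) * 3 ^ card (prime_factors q) \<le> 3 ^ card (prime_factors n) / real (n div q)"
proof -
  have n: "n = q * (n div q)" using q by simp
  have "squarefree (q * (n div q))" using sf n by simp
  then have card: "card (prime_factors n) = card (prime_factors q) + card (prime_factors (n div q))"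
    using card_prime_factors_squarefree_mult n by metis
  have "squarefree (n div q)" using sf n by (metis dvd_triv_right squarefree_mono)
  then have "rho (n div q) \<le> 2 ^ card (prime_factors (n div q)) / real (n div q)" by (rule rho_le)
  also have "\<dots> \<le> 3 ^ card (prime_factors (n div q)) / real (n div q)"
    by (intro divide_right_mono power_mono) auto
  finally show ?thesis
    using mult_right_mono[of _ _ "3 ^ card (prime_factors q)"] by (fastforce simp: card power_add mult.commute)
qed

lemma abs_Xi_le_1: "\<bar>Xi q n\<bar> \<le> 1"
proof -
  have "\<bar>Xi q n\<bar> \<le> (\<Prod>p\<in>prime_factors q. 1)"
    unfolding Xi_def abs_prod
  proof (intro prod_mono conjI)
    fix p assume "p \<in> prime_factors q"
    then have "rho p \<le> 1" using rho_prime_le(1) by blast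
    then show "\<bar>(if int p dvd n then 1 else 0) - rho p\<bar> \<le> 1" using rho_nonneg[of p] by auto
  qed simp
  then show ?thesis by simp
qed

lemma admissible_prime_factor:
  assumes "admissible B f q" "2 dvd B" "p \<in> prime_factors q"
  shows "odd p" "f = Fz \<Longrightarrow> [p = 1] (mod 4)" "beta_p B f p = 2 / (real p + 1)"
proof -
  have p: "prime p" "p dvd q" using assms(3) by auto
  have cop: "coprime p B" using assms(1) coprime_divisors[OF p(2) dvd_refl] by (simp add: admissible_def)
  show "odd p"
  proof
    assume "even p"
    then have "is_unit (2::nat)" using coprime_common_divisor[OF cop _ assms(2)] by simp
    then show False by simp
  qed
  show f: "f = Fz \<Longrightarrow> [p = 1] (mod 4)" using assms by (auto simp: admissible_def)
  show "beta_p B f p = 2 / (real p + 1)" using cop f by (cases f) (auto simp: beta_p_def)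
qed

lemma admissible_dvd:
  assumes "admissible B f n" "q dvd n"
  shows "admissible B f q"
proof -
  have "n \<noteq> 0" using assms(1) squarefree_pos[of n] by (simp add: admissible_def)
  then have "prime_factors q \<subseteq> prime_factors n" using assms(2) by (simp add: dvd_prime_factors)
  moreover have "squarefree q" "coprime q B"
    using assms(1) squarefree_mono[OF assms(2)] coprime_divisors[OF assms(2) dvd_refl]
    by (simp_all add: admissible_def)
  ultimately show ?thesis using assms(1) by (auto simp: admissible_def)
qed

text \<open>For fixed \<open>w\<close> this is the sieve weight estimate with
  \<open>r = rho\<close>, and its error is uniform in \<open>w\<close>; summing over
  \<open>Omega G Y\<close> multiplies it by the cardinality.\<close>

lemma weighted_Xi_sum:
  fixes u :: "imat \<Rightarrow> real"
  assumes G: "is_subgroup_SL2 G" and B: "2 dvd B"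
    and bad: "\<And>q. squarefree q \<Longrightarrow> coprime q B \<Longrightarrow> surj_mod G q"
    and q: "admissible B f q"
    and S: "finite S" "\<And>g. g \<in> G \<Longrightarrow> g \<notin> S \<Longrightarrow> u g = 0"
    and equi: "\<And>g0 d H. g0 \<in> G \<Longrightarrow> squarefree d \<Longrightarrow> coprime d B \<Longrightarrow> is_subgroup_SL2 H \<Longrightarrow>
      principal_congruence G d \<subseteq> H \<Longrightarrow> H \<subseteq> G \<Longrightarrow>
      \<bar>(\<Sum>\<^sub>\<infinity>g\<in>H. u (g ** g0)) - (\<Sum>\<^sub>\<infinity>g\<in>G. u g) / real (index H G)\<bar> \<le> E"
  shows "\<bar>(\<Sum>\<^sub>\<infinity>g\<in>G. u g * (\<Sum>w\<in>Omega G Y. Xi q (feval f (x0 v* (g ** w)))))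
           - gap B f q * (real (card (Omega G Y)) * (\<Sum>\<^sub>\<infinity>g\<in>G. u g))\<bar>
         \<le> 3 ^ card (prime_factors q) * (real (card (Omega G Y)) * E)"
proof -
  let ?P = "prime_factors q"
  let ?S = "\<Sum>\<^sub>\<infinity>g\<in>G. u g"
  let ?x = "\<lambda>g w. Xi q (feval f (x0 v* (g ** w)))"
  have sf: "squarefree q" "coprime q B" using q by (auto simp: admissible_def)
  have D: "squarefree (\<Prod>D)" "coprime (\<Prod>D) B" if "D \<subseteq> ?P" for D
  proof -
    show "squarefree (\<Prod>D)" using that by (intro squarefree_prod_primes) auto
    have "\<Prod>D dvd \<Prod>?P" by (rule prod_dvd_prod_subset[OF _ that]) simp
    then have "\<Prod>D dvd q" by (simp only: prod_prime_factors_squarefree[OF sf(1)])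
    then show "coprime (\<Prod>D) B" by (rule coprime_divisors[OF _ dvd_refl sf(2)])
  qed
  have gap: "gap B f q = (\<Prod>p\<in>?P. 2 / (real p + 1) - rho p)"
    unfolding gap_def using admissible_prime_factor(3)[OF q B] by (intro prod.cong) auto
  have each: "\<bar>(\<Sum>\<^sub>\<infinity>g\<in>G. u g * ?x g w) - gap B f q * ?S\<bar> \<le> 3 ^ card ?P * E"
    if w: "w \<in> Omega G Y" for w
    unfolding Xi_def gap
  proof (rule equidistribution_sieve_weight[OF G])
    show "w \<in> G" using w by (simp add: Omega_def)
    show "surj_mod G (\<Prod>D)" if "D \<subseteq> ?P" for D using bad D[OF that] by blast
    show "\<bar>(\<Sum>\<^sub>\<infinity>g\<in>Gamma0 G D. u (g ** g0)) - ?S / real (index (Gamma0 G D) G)\<bar> \<le> E"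
      if "D \<subseteq> ?P" "g0 \<in> G" for D g0
    proof -
      have "finite D" using that(1) by (rule finite_subset) simp
      then show ?thesis
        by (rule equi[OF that(2) D[OF that(1)] subgroup_Gamma0[OF G] principal_congruence_le_Gamma0 Gamma0_subset])
    qed
    show "odd p" if "p \<in> ?P" for p using admissible_prime_factor(1)[OF q B that] .
    show "[p = 1] (mod 4)" if "p \<in> ?P" "f = Fz" for p using admissible_prime_factor(2)[OF q B that] .
    show "0 \<le> rho p \<and> rho p \<le> 1" if "p \<in> ?P" for p
      using that rho_nonneg rho_prime_le(1) by auto
  qed (use S in auto)
  have fin: "infsum (\<lambda>g. u g * v g) G = (\<Sum>g\<in>G \<inter> S. u g * v g)" for v
    by (rule infsum_finite_support[OF S(1)]) (use S(2) in auto)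
  have "(\<Sum>\<^sub>\<infinity>g\<in>G. u g * (\<Sum>w\<in>Omega G Y. ?x g w)) = (\<Sum>w\<in>Omega G Y. \<Sum>\<^sub>\<infinity>g\<in>G. u g * ?x g w)"
    unfolding fin unfolding sum_distrib_left by (rule sum.swap)
  then have "(\<Sum>\<^sub>\<infinity>g\<in>G. u g * (\<Sum>w\<in>Omega G Y. ?x g w)) - gap B f q * (real (card (Omega G Y)) * ?S)
      = (\<Sum>w\<in>Omega G Y. (\<Sum>\<^sub>\<infinity>g\<in>G. u g * ?x g w) - gap B f q * ?S)"
    by (simp add: sum_subtractf mult_ac)
  also have "\<bar>\<dots>\<bar> \<le> (\<Sum>w\<in>Omega G Y. 3 ^ card ?P * E)"
    using each by (intro order_trans[OF sum_abs] sum_mono)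
  finally show ?thesis by (simp add: mult_ac)
qed

text \<open>Serves bounded \<open>X\<close>: since \<open>Xi\<close> and \<open>gap\<close> are at
  most 1 in absolute value, each of the two terms is at most the total mass.\<close>

lemma weighted_Xi_sum_trivial:
  fixes u :: "imat \<Rightarrow> real"
  assumes B: "2 dvd B" and q: "admissible B f q"
    and S: "finite S" "\<And>g. g \<in> G \<Longrightarrow> g \<notin> S \<Longrightarrow> u g = 0" and u: "\<And>g. 0 \<le> u g"
  shows "\<bar>(\<Sum>\<^sub>\<infinity>g\<in>G. u g * (\<Sum>w\<in>Omega G Y. Xi q (feval f (x0 v* (g ** w)))))
           - gap B f q * (real (card (Omega G Y)) * (\<Sum>\<^sub>\<infinity>g\<in>G. u g))\<bar>
         \<le> 2 * (real (card (Omega G Y)) * (\<Sum>\<^sub>\<infinity>g\<in>G. u g))"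
proof -
  let ?N = "real (card (Omega G Y))" and ?S = "\<Sum>\<^sub>\<infinity>g\<in>G. u g"
  let ?x = "\<lambda>g. \<Sum>w\<in>Omega G Y. Xi q (feval f (x0 v* (g ** w)))"
  have fin: "infsum (\<lambda>g. u g * v g) G = (\<Sum>g\<in>G \<inter> S. u g * v g)" for v
    by (rule infsum_finite_support[OF S(1)]) (use S(2) in auto)
  have SS: "?S = (\<Sum>g\<in>G \<inter> S. u g)" using fin[of "\<lambda>_. 1"] by simp
  then have S0: "?S \<ge> 0" using u by (simp add: sum_nonneg)
  have xN: "\<bar>?x g\<bar> \<le> ?N" for g
    using order_trans[OF sum_abs sum_bounded_above[of "Omega G Y" "\<lambda>w. \<bar>Xi q (feval f (x0 v* (g ** w)))\<bar>" 1]]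
      abs_Xi_le_1 by simp
  have "\<bar>\<Sum>g\<in>G \<inter> S. u g * ?x g\<bar> \<le> (\<Sum>g\<in>G \<inter> S. u g * ?N)"
    using u xN by (intro order_trans[OF sum_abs] sum_mono) (auto simp: abs_mult intro!: mult_left_mono)
  then have 1: "\<bar>\<Sum>\<^sub>\<infinity>g\<in>G. u g * ?x g\<bar> \<le> ?N * ?S"
    unfolding fin SS by (simp add: sum_distrib_right mult.commute)
  have sf: "squarefree q" using q by (simp add: admissible_def)
  then have "q \<noteq> 0" using squarefree_pos[of q] by simp
  then have "1 / (real q)\<^sup>2 \<le> 1" by (simp add: divide_simps)
  then have "\<bar>gap B f q\<bar> \<le> 1"
    using abs_gap_le[OF sf admissible_prime_factor(3)[OF q B]] by (rule order_trans[rotated])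
  then have "\<bar>gap B f q\<bar> * (?N * ?S) \<le> 1 * (?N * ?S)" using S0 by (intro mult_right_mono) auto
  then have "\<bar>gap B f q * (?N * ?S)\<bar> \<le> ?N * ?S" using S0 by (simp add: abs_mult)
  then show ?thesis using 1 by linarith
qed

lemma asymp_powr_lower_bound:
  fixes F :: "real \<Rightarrow> real"
  assumes "F \<sim>[at_top] (\<lambda>X. C * X powr a)" "C > 0"
  obtains X1 where "X1 \<ge> 1" "\<And>X. X \<ge> X1 \<Longrightarrow> C / 2 * X powr a \<le> F X"
proof -
  \<comment> \<open>The conditional is the convention \<open>0 / 0 = 1\<close> in asymptotic
    equivalence; for \<open>X >= 1\<close> the denominator is positive and only the quotient
    remains.\<close>
  have "\<forall>\<^sub>F X in at_top. (if F X = 0 \<and> C * X powr a = 0 then 1 else F X / (C * X powr a)) > 1 / 2"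
    by (rule order_tendstoD(1)[OF asymp_equivD[OF assms(1)]]) simp
  then obtain X0 where X0: "\<And>X. X \<ge> X0 \<Longrightarrow>
      (if F X = 0 \<and> C * X powr a = 0 then 1 else F X / (C * X powr a)) > 1 / 2"
    unfolding eventually_at_top_linorder by blast
  show thesis
  proof (rule that[of "max 1 X0"])
    fix X assume X: "X \<ge> max 1 X0"
    then have pos: "C * X powr a > 0" using assms(2) by simp
    then have "F X / (C * X powr a) > 1 / 2" using X0[of X] X by (simp split: if_splits)
    then show "C / 2 * X powr a \<le> F X" using pos by (simp add: field_simps)
  qed simp
qed

subsection \<open>The decomposition\<close>

theorem theorem6:
  fixes G :: "imat set" and B :: nat and delta theta :: real
    and Ups :: "real \<Rightarrow> imat \<Rightarrow> real" and f :: quad_form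
    and xe ye eta :: real
  assumes subgrp: "is_subgroup_SL2 G"
    and fg: "finitely_generated G"
    and zd: "zariski_dense_SL2 G"
    and thin: "infinite_index G"
    and nopar: "no_parabolics G"
    and delta_def: "delta = critical_exponent G"
    and delta_gt: "delta > 1/2"
    and theta_lt: "theta < delta"
    and B_even: "2 dvd B"
    and B_bad: "\<And>q. squarefree q \<Longrightarrow> coprime q B \<Longrightarrow> surj_mod G q"
    and Ups_range: "\<And>X g. 0 \<le> Ups X g \<and> Ups X g \<le> 1"
    and Ups_one: "\<And>X g. mnorm g < 9/10 * X \<Longrightarrow> Ups X g = 1"
    and Ups_zero: "\<And>X g. mnorm g > 11/10 * X \<Longrightarrow> Ups X g = 0"
    and Ups_asymp: "\<exists>C>0. (\<lambda>X. \<Sum>\<^sub>\<infinity>g\<in>G. Ups X g) \<sim>[at_top] (\<lambda>X. C * X powr (2 * delta))"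
    and Ups_equi: "\<exists>C0. \<forall>X\<ge>1. \<forall>g0\<in>G. \<forall>q H. squarefree q \<longrightarrow> coprime q B \<longrightarrow>
          is_subgroup_SL2 H \<longrightarrow> principal_congruence G q \<subseteq> H \<longrightarrow> H \<subseteq> G \<longrightarrow>
          \<bar>(\<Sum>\<^sub>\<infinity>g\<in>H. Ups X (g ** g0)) - (\<Sum>\<^sub>\<infinity>g\<in>G. Ups X g) / real (index H G)\<bar>
            \<le> C0 * X powr (2 * theta)"
    and xy: "xe > 0" "ye > 0" "xe + ye = 1"
    and eta: "eta > 0"
  shows "\<exists>r1 r2 :: real \<Rightarrow> nat \<Rightarrow> real.
     (\<forall>T qq. admissible B f qq \<longrightarrow>
        main_term G Ups f (T powr xe) (T powr ye) (T powr eta) qq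
          = beta B f qq * chi G Ups (T powr xe) (T powr ye) + r1 T qq + r2 T qq) \<and>
     (\<forall>\<epsilon>>0. \<exists>C. \<forall>T\<ge>1. \<forall>Q\<ge>1.
        (\<Sum>qq\<in>{qq. real qq < Q \<and> admissible B f qq}. \<bar>r1 T qq\<bar>)
          \<le> C * chi G Ups (T powr xe) (T powr ye) * Q powr \<epsilon> * T powr eta
              / (T powr xe) powr (2 * (delta - theta)) \<and>
        (\<Sum>qq\<in>{qq. real qq < Q \<and> admissible B f qq}. \<bar>r2 T qq\<bar>)
          \<le> C * chi G Ups (T powr xe) (T powr ye) * Q powr \<epsilon> / T powr eta)"
proof -
  define S where "S = (\<lambda>X. \<Sum>\<^sub>\<infinity>g\<in>G. Ups X g)"
  define W where "W = (\<lambda>X Y q. \<Sum>\<^sub>\<infinity>g\<in>G. Ups X g * (\<Sum>w\<in>Omega G Y. Xi q (feval f (x0 v* (g ** w)))))"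
  \<comment> \<open>The saving in equidistribution: \<open>X powr (2 * theta)\<close> is
    \<open>X powr (2 * delta)\<close> divided by \<open>X powr a\<close>.\<close>
  define a where "a = 2 * (delta - theta)"
  have a: "a > 0" using theta_lt by (simp add: a_def)
  have chi: "chi G Ups X Y = real (card (Omega G Y)) * S X" for X Y by (simp add: chi_def S_def)
  let ?F = "\<lambda>X. {A. mnorm A \<le> 11/10 * X}"
  have F: "finite (?F X)" "\<And>g. g \<notin> ?F X \<Longrightarrow> Ups X g = 0" for X
    by (rule finite_mnorm_le) (use Ups_zero in auto)
  have S0: "S X \<ge> 0" for X using Ups_range by (auto simp: S_def intro: infsum_nonneg)
  have chi0: "chi G Ups X Y \<ge> 0" for X Y using S0 by (simp add: chi)

  obtain C where C: "C > 0" "S \<sim>[at_top] (\<lambda>X. C * X powr (2 * delta))"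
    using Ups_asymp unfolding S_def by blast
  obtain X1 where X1: "X1 \<ge> 1" "\<And>X. X \<ge> X1 \<Longrightarrow> C / 2 * X powr (2 * delta) \<le> S X"
    using asymp_powr_lower_bound[OF C(2,1)] by blast
  obtain C0 where C0: "\<And>X g0 q H. X \<ge> 1 \<Longrightarrow> g0 \<in> G \<Longrightarrow> squarefree q \<Longrightarrow> coprime q B \<Longrightarrow>
      is_subgroup_SL2 H \<Longrightarrow> principal_congruence G q \<subseteq> H \<Longrightarrow> H \<subseteq> G \<Longrightarrow>
      \<bar>(\<Sum>\<^sub>\<infinity>g\<in>H. Ups X (g ** g0)) - S X / real (index H G)\<bar> \<le> C0 * X powr (2 * theta)"
    using Ups_equi unfolding S_def by blast
  \<comment> \<open>The first entry converts the error \<open>C0 * X powr (2 * theta)\<close> into a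
    multiple of \<open>S X / X powr a\<close> for \<open>X >= X1\<close>; the second covers
    \<open>X < X1\<close>, where the trivial factor 2 is at most
    \<open>2 * X1 powr a / X powr a\<close>.\<close>
  define K where "K = max (2 * \<bar>C0\<bar> / C) (2 * X1 powr a)"
  have K: "K \<ge> 0" "2 * \<bar>C0\<bar> / C \<le> K" "2 * X1 powr a \<le> K" by (auto simp: K_def le_max_iff_disj)

  have W_bound: "\<bar>W X Y q - gap B f q * chi G Ups X Y\<bar>
      \<le> 3 ^ card (prime_factors q) * (K * chi G Ups X Y / X powr a)"
    if X: "X \<ge> 1" and q: "admissible B f q" for X Y q
  proof (cases "X \<ge> X1")
    case True
    have "C0 * X powr (2 * theta) \<le> \<bar>C0\<bar> * X powr (2 * theta)" by (simp add: mult_right_mono)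
    also have "\<bar>C0\<bar> * X powr (2 * theta) = 2 * \<bar>C0\<bar> / C * (C / 2 * X powr (2 * delta)) / X powr a"
      using X C(1) by (simp add: a_def right_diff_distrib powr_diff)
    also have "\<dots> \<le> K * S X / X powr a"
      using X1(2)[OF True] K C(1) by (intro divide_right_mono mult_mono) auto
    finally have E: "C0 * X powr (2 * theta) \<le> K * S X / X powr a" .
    have "\<bar>W X Y q - gap B f q * chi G Ups X Y\<bar>
        \<le> 3 ^ card (prime_factors q) * (real (card (Omega G Y)) * (C0 * X powr (2 * theta)))"
      unfolding W_def chi S_def
      by (rule weighted_Xi_sum[OF subgrp B_even B_bad q F(1) F(2)])
        (auto intro: C0[OF X, unfolded S_def])
    also have "\<dots> \<le> 3 ^ card (prime_factors q) * (real (card (Omega G Y)) * (K * S X / X powr a))"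
      using E by (intro mult_left_mono) auto
    finally show ?thesis by (simp add: chi mult_ac)
  next
    case False
    have "\<bar>W X Y q - gap B f q * chi G Ups X Y\<bar> \<le> 2 * chi G Ups X Y"
      unfolding W_def chi S_def
      by (rule weighted_Xi_sum_trivial[OF B_even q F(1) F(2)]) (use Ups_range in auto)
    also have "\<dots> \<le> (2 * X1 powr a / X powr a) * chi G Ups X Y"
    proof (rule mult_right_mono[OF _ chi0])
      have "X powr a \<le> X1 powr a" using X False a by (intro powr_mono2) auto
      then show "2 \<le> 2 * X1 powr a / X powr a" using X by (simp add: divide_simps)
    qed
    also have "\<dots> \<le> K * chi G Ups X Y / X powr a"
      using K(3) chi0[of X Y] by (simp add: divide_right_mono mult_right_mono)
    also have "\<dots> \<le> 3 ^ card (prime_factors q) * (K * chi G Ups X Y / X powr a)"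
      using mult_right_mono[of 1 "3 ^ card (prime_factors q)" "K * chi G Ups X Y / X powr a"] K(1) chi0[of X Y]
      by simp
    finally show ?thesis .
  qed

  \<comment> \<open>\<open>r2\<close> is minus the tail \<open>q >= T powr eta\<close> of the
    convolution giving \<open>beta\<close>, and \<open>r1\<close> is whatever remains, so the
    decomposition itself holds by definition.\<close>
  define r2 where "r2 = (\<lambda>T n. - (chi G Ups (T powr xe) (T powr ye) *
      (\<Sum>q | q dvd n \<and> T powr eta \<le> real q. rho (n div q) * gap B f q)))"
  define r1 where "r1 = (\<lambda>T n. main_term G Ups f (T powr xe) (T powr ye) (T powr eta) n
      - beta B f n * chi G Ups (T powr xe) (T powr ye) - r2 T n)"

  \<comment> \<open>Splitting the convolution for \<open>beta\<close> at \<open>T powr eta\<close>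
    cancels the tail against \<open>r2\<close> and leaves only the equidistribution errors for small
    \<open>q\<close>.\<close>
  have r1_eq: "r1 T n = (\<Sum>q | q dvd n \<and> real q < T powr eta. rho (n div q) *
      (W (T powr xe) (T powr ye) q - gap B f q * chi G Ups (T powr xe) (T powr ye)))"
    if "admissible B f n" for T n
  proof -
    let ?c = "chi G Ups (T powr xe) (T powr ye)"
    have sf: "squarefree n" using that by (simp add: admissible_def)
    have fin: "finite {q. q dvd n}" using squarefree_pos[OF sf] by simp
    let ?lo = "{q. q dvd n \<and> real q < T powr eta}" and ?hi = "{q. q dvd n \<and> T powr eta \<le> real q}"
    let ?t = "\<lambda>q. rho (n div q) * gap B f q"
    have "beta B f n = sum ?t {q. q dvd n}" by (rule sum_rho_gap[OF sf, symmetric])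
    also have "{q. q dvd n} = ?lo \<union> ?hi" by auto
    also have "sum ?t (?lo \<union> ?hi) = sum ?t ?lo + sum ?t ?hi"
    proof (rule sum.union_disjoint)
      show "finite ?lo" "finite ?hi" by (rule finite_subset[OF _ fin], blast)+
      show "?lo \<inter> ?hi = {}" by auto
    qed
    finally have beta: "beta B f n = sum ?t ?lo + sum ?t ?hi" .
    have "r1 T n = (\<Sum>q\<in>?lo. rho (n div q) * W (T powr xe) (T powr ye) q) - ?c * sum ?t ?lo"
      unfolding r1_def r2_def main_term_def W_def beta by (simp add: distrib_right mult.commute[of ?c])
    also have "\<dots> = (\<Sum>q\<in>?lo. rho (n div q) * (W (T powr xe) (T powr ye) q - gap B f q * ?c))"
      by (simp add: sum_distrib_left right_diff_distrib sum_subtractf mult_ac)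
    finally show ?thesis .
  qed

  have r1_le: "\<bar>r1 T n\<bar> \<le> (\<Sum>q | q dvd n \<and> real q < T powr eta. 3 ^ card (prime_factors n) / real (n div q) *
      (K * chi G Ups (T powr xe) (T powr ye) / (T powr xe) powr a))"
    if T: "T \<ge> 1" and n: "admissible B f n" for T n
    unfolding r1_eq[OF n]
  proof (intro order_trans[OF sum_abs] sum_mono)
    fix q assume "q \<in> {q. q dvd n \<and> real q < T powr eta}"
    then have q: "q dvd n" by simp
    let ?k = "K * chi G Ups (T powr xe) (T powr ye) / (T powr xe) powr a"
    have k: "?k \<ge> 0" using K(1) chi0 by simp
    have X: "T powr xe \<ge> 1" using T xy by (simp add: ge_one_powr_ge_zero)
    let ?d = "W (T powr xe) (T powr ye) q - gap B f q * chi G Ups (T powr xe) (T powr ye)"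
    have "\<bar>rho (n div q) * ?d\<bar> = rho (n div q) * \<bar>?d\<bar>" using rho_nonneg by (simp add: abs_mult)
    also have "\<dots> \<le> rho (n div q) * (3 ^ card (prime_factors q) * ?k)"
      by (rule mult_left_mono[OF W_bound[OF X admissible_dvd[OF n q]] rho_nonneg])
    also have "\<dots> = rho (n div q) * 3 ^ card (prime_factors q) * ?k" by simp
    also have "\<dots> \<le> 3 ^ card (prime_factors n) / real (n div q) * ?k"
      using n by (intro mult_right_mono[OF rho_cofactor_le[OF _ q] k]) (simp add: admissible_def)
    finally show "\<bar>rho (n div q) * ?d\<bar> \<le> 3 ^ card (prime_factors n) / real (n div q) * ?k" .
  qed

  have r2_le: "\<bar>r2 T n\<bar> \<le> (\<Sum>q | q dvd n \<and> T powr eta \<le> real q. 3 ^ card (prime_factors n) / real (n div q) *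
      (chi G Ups (T powr xe) (T powr ye) * (1 / (real q)\<^sup>2)))"
    if n: "admissible B f n" for T n
  proof -
    let ?c = "chi G Ups (T powr xe) (T powr ye)"
    have "\<bar>r2 T n\<bar> = ?c * \<bar>\<Sum>q | q dvd n \<and> T powr eta \<le> real q. rho (n div q) * gap B f q\<bar>"
      using chi0 by (simp add: r2_def abs_mult)
    also have "\<dots> \<le> ?c * (\<Sum>q | q dvd n \<and> T powr eta \<le> real q.
        3 ^ card (prime_factors n) / real (n div q) * (1 / (real q)\<^sup>2))"
    proof (intro mult_left_mono chi0 order_trans[OF sum_abs] sum_mono)
      fix q assume "q \<in> {q. q dvd n \<and> T powr eta \<le> real q}"
      then have q: "q dvd n" by simp
      have sf: "squarefree q" using admissible_dvd[OF n q] by (simp add: admissible_def)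
      have "\<bar>gap B f q\<bar> \<le> 1 / (real q)\<^sup>2"
        by (rule abs_gap_le[OF sf admissible_prime_factor(3)[OF admissible_dvd[OF n q] B_even]])
      \<comment> \<open>Inserting this power of 3 is wasteful, but it gives \<open>r2\<close> the
        same divisor weight as \<open>r1\<close>, so one divisor sum bound serves both.\<close>
      moreover have "rho (n div q) * 1 \<le> rho (n div q) * 3 ^ card (prime_factors q)"
        by (intro mult_left_mono rho_nonneg) simp
      then have "rho (n div q) \<le> 3 ^ card (prime_factors n) / real (n div q)"
        using rho_cofactor_le[OF _ q] n by (simp add: admissible_def)
      ultimately show "\<bar>rho (n div q) * gap B f q\<bar>
          \<le> 3 ^ card (prime_factors n) / real (n div q) * (1 / (real q)\<^sup>2)"
        unfolding abs_mult abs_of_nonneg[OF rho_nonneg] by (intro mult_mono) auto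
    qed
    finally show ?thesis by (simp add: sum_distrib_left mult_ac)
  qed

  have bounds: "\<exists>C. \<forall>T\<ge>1. \<forall>Q\<ge>1.
        (\<Sum>qq\<in>{qq. real qq < Q \<and> admissible B f qq}. \<bar>r1 T qq\<bar>)
          \<le> C * chi G Ups (T powr xe) (T powr ye) * Q powr \<epsilon> * T powr eta
              / (T powr xe) powr (2 * (delta - theta)) \<and>
        (\<Sum>qq\<in>{qq. real qq < Q \<and> admissible B f qq}. \<bar>r2 T qq\<bar>)
          \<le> C * chi G Ups (T powr xe) (T powr ye) * Q powr \<epsilon> / T powr eta"
    if \<epsilon>: "\<epsilon> > 0" for \<epsilon> :: real
  proof -
    obtain D where D: "D \<ge> 0"
      "\<And>A R (w :: nat \<Rightarrow> real) (Q :: real). Q \<ge> 1 \<Longrightarrow> (\<And>n. n \<in> A \<Longrightarrow> squarefree n \<and> real n < Q) \<Longrightarrow> (\<And>q. 0 \<le> w q) \<Longrightarrow>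
        (\<Sum>n\<in>A. \<Sum>q | q dvd n \<and> R q. 3 ^ card (prime_factors n) / real (n div q) * w q)
          \<le> D * Q powr \<epsilon> * (\<Sum>q | 1 \<le> q \<and> real q < Q \<and> R q. w q)"
      using sum_divisors_le[OF \<epsilon>] by blast
    \<comment> \<open>One constant must serve both bounds: \<open>K\<close> comes from
      \<open>r1\<close>, and \<open>2\<close> from the tail of the inverse squares in
      \<open>r2\<close>.\<close>
    have "(\<Sum>n\<in>A. \<bar>r1 T n\<bar>) \<le> (K + 2) * D * c * Q powr \<epsilon> * T powr eta / (T powr xe) powr a"
        "(\<Sum>n\<in>A. \<bar>r2 T n\<bar>) \<le> (K + 2) * D * c * Q powr \<epsilon> / T powr eta"
      if T: "T \<ge> 1" and Q: "Q \<ge> 1" and A_def: "A = {n. real n < Q \<and> admissible B f n}"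
        and c_def: "c = chi G Ups (T powr xe) (T powr ye)" for T Q A c
    proof -
      have A: "squarefree n \<and> real n < Q" if "n \<in> A" for n
        using that by (simp add: A_def admissible_def)
      have c: "c \<ge> 0" using chi0 by (simp add: c_def)
      let ?k = "K * c / (T powr xe) powr a"
      have k: "?k \<ge> 0" using K(1) c by simp
      have eT: "T powr eta > 0" using T by simp
      have "(\<Sum>n\<in>A. \<bar>r1 T n\<bar>)
          \<le> (\<Sum>n\<in>A. \<Sum>q | q dvd n \<and> real q < T powr eta. 3 ^ card (prime_factors n) / real (n div q) * ?k)"
        unfolding c_def using r1_le[OF T] by (intro sum_mono) (simp add: A_def)
      also have "\<dots> \<le> D * Q powr \<epsilon> * (\<Sum>q | 1 \<le> q \<and> real q < Q \<and> real q < T powr eta. ?k)"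
        by (rule D(2)[OF Q A k])
      also have "\<dots> = D * Q powr \<epsilon> * (real (card {q. 1 \<le> q \<and> real q < Q \<and> real q < T powr eta}) * ?k)"
        by simp
      \<comment> \<open>The weight \<open>?k\<close> is constant in \<open>q\<close>, so counting
        the \<open>q\<close> below \<open>T powr eta\<close> costs exactly one factor
        \<open>T powr eta\<close>.\<close>
      also have "\<dots> \<le> D * Q powr \<epsilon> * (T powr eta * ?k)"
      proof (intro mult_left_mono mult_right_mono k)
        let ?U = "{q. 1 \<le> q \<and> real q < min Q (T powr eta)}"
        have "{q. 1 \<le> q \<and> real q < Q \<and> real q < T powr eta} = ?U" by auto
        moreover have "real (card ?U) \<le> min Q (T powr eta)"
          using Q by (intro card_nat_less_real_le) simp
        ultimately show "real (card {q. 1 \<le> q \<and> real q < Q \<and> real q < T powr eta}) \<le> T powr eta"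
          by simp
      qed (use D(1) in auto)
      also have "\<dots> = K * (D * c * Q powr \<epsilon> * T powr eta / (T powr xe) powr a)" by simp
      also have "\<dots> \<le> (K + 2) * (D * c * Q powr \<epsilon> * T powr eta / (T powr xe) powr a)"
        using D(1) c by (intro mult_right_mono) auto
      finally show "(\<Sum>n\<in>A. \<bar>r1 T n\<bar>) \<le> (K + 2) * D * c * Q powr \<epsilon> * T powr eta / (T powr xe) powr a"
        by (simp add: mult_ac)
      have "(\<Sum>n\<in>A. \<bar>r2 T n\<bar>)
          \<le> (\<Sum>n\<in>A. \<Sum>q | q dvd n \<and> T powr eta \<le> real q. 3 ^ card (prime_factors n) / real (n div q) * (c * (1 / (real q)\<^sup>2)))"
        unfolding c_def using r2_le by (intro sum_mono) (simp add: A_def)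
      also have "\<dots> \<le> D * Q powr \<epsilon> * (\<Sum>q | 1 \<le> q \<and> real q < Q \<and> T powr eta \<le> real q. c * (1 / (real q)\<^sup>2))"
        by (rule D(2)[OF Q A]) (use c in auto)
      also have "\<dots> \<le> D * Q powr \<epsilon> * (c * (2 / T powr eta))"
      proof (rule mult_left_mono)
        \<comment> \<open>Positivity of \<open>T powr eta\<close> already excludes
          \<open>q = 0\<close>.\<close>
        have "{q. 1 \<le> q \<and> real q < Q \<and> T powr eta \<le> real q} = {q. T powr eta \<le> real q \<and> real q < Q}"
          using eT by (auto simp: Suc_le_eq intro!: Nat.gr0I)
        then show "(\<Sum>q | 1 \<le> q \<and> real q < Q \<and> T powr eta \<le> real q. c * (1 / (real q)\<^sup>2)) \<le> c * (2 / T powr eta)"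
          using sum_inverse_squares_le[OF eT, of Q] c
          by (simp only: sum_distrib_left[symmetric] mult_left_mono)
      qed (use D(1) in auto)
      also have "\<dots> = 2 * (D * c * Q powr \<epsilon> / T powr eta)" by simp
      also have "\<dots> \<le> (K + 2) * (D * c * Q powr \<epsilon> / T powr eta)"
        using D(1) c K(1) by (intro mult_right_mono) auto
      finally show "(\<Sum>n\<in>A. \<bar>r2 T n\<bar>) \<le> (K + 2) * D * c * Q powr \<epsilon> / T powr eta"
        by (simp add: mult_ac)
    qed
    note bound = this[OF _ _ refl refl, unfolded a_def]
    show ?thesis by (intro exI[of _ "(K + 2) * D"] allI impI conjI bound)
  qed
  have "main_term G Ups f (T powr xe) (T powr ye) (T powr eta) n
      = beta B f n * chi G Ups (T powr xe) (T powr ye) + r1 T n + r2 T n" for T n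
    by (simp add: r1_def)
  then show ?thesis using bounds by (intro exI[of _ r1] exI[of _ r2] conjI allI impI)
qed

end
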